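(* Let $n\geq 2$, $m\geq 1$, and let $W\in C^1(\mathbb{R}^m;\mathbb{R})$ be such that there exists $a\in\mathbb{R}^m$ with $W>0$ in $\mathbb{R}^m\setminus\{a\}$ and $W(a)=0$. If $u\in C^2(\mathbb{R}^n;\mathbb{R}^m)$ is a bounded, globally minimizing solution of $\Delta u=\nabla W(u)$ in $\mathbb{R}^n$, then \[ \lim_{R\to\infty}\left(\frac{1}{R^{n-1}}\int_{B_R}\left\{\frac12|\nabla u|^2+W(u)\right\}dx\right)=0, \] where $B_R$ is the ball in $\mathbb{R}^n$ of radius $R$ centered at the origin.
   Context: For a smooth bounded domain $\Omega\subset\mathbb{R}^n$ and $v:\Omega\to\mathbb{R}^m$, the energy is $E(v;\Omega)=\int_\Omega\{\frac12|\nabla v|^2+W(v)\}dx$, where $|\nabla v|^2=\sum_{i=1}^n|v_{x_i}|^2$. A solution $u\in C^2(\mathbb{R}^n;\mathbb{R}^m)$ is called globally minimizing if $E(u;\Omega)\leq E(u+\varphi;\Omega)$ for every smooth bounded domain $\Omega\subset\mathbb{R}^n$ and every $\varphi\in W^{1,2}_0(\Omega;\mathbb{R}^m)\cap L^\infty(\Omega;\mathbb{R}^m)$. *)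

theory Defs
  imports "HOL-Analysis.Analysis"
begin

definition pderiv_dir :: "(real^'n \<Rightarrow> 'b::real_normed_vector) \<Rightarrow> 'n \<Rightarrow> real^'n \<Rightarrow> 'b" where
  "pderiv_dir f i x = frechet_derivative f (at x) (axis i 1)"

fun iter_pderiv :: "(real^'n \<Rightarrow> 'b::real_normed_vector) \<Rightarrow> 'n list \<Rightarrow> real^'n \<Rightarrow> 'b" where
  "iter_pderiv f [] = f"
| "iter_pderiv f (i # is) = pderiv_dir (iter_pderiv f is) i"

definition C1_fun :: "(real^'m \<Rightarrow> real) \<Rightarrow> bool" where
  "C1_fun W \<longleftrightarrow> (\<forall>y. W differentiable (at y)) \<and> (\<forall>j. continuous_on UNIV (pderiv_dir W j))"

definition C2_fun :: "(real^'n \<Rightarrow> real^'m) \<Rightarrow> bool" where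
  "C2_fun u \<longleftrightarrow> (\<forall>x. u differentiable (at x)) \<and>
     (\<forall>i x. pderiv_dir u i differentiable (at x)) \<and>
     (\<forall>i j. continuous_on UNIV (pderiv_dir (pderiv_dir u i) j))"

definition smooth_on :: "(real^'n) set \<Rightarrow> (real^'n \<Rightarrow> 'b::real_normed_vector) \<Rightarrow> bool" where
  "smooth_on U f \<longleftrightarrow> (\<forall>is. (\<forall>x\<in>U. iter_pderiv f is differentiable (at x)) \<and>
                              continuous_on U (iter_pderiv f is))"

definition grad :: "(real^'m \<Rightarrow> real) \<Rightarrow> real^'m \<Rightarrow> real^'m" where
  "grad W y = (\<chi> j. pderiv_dir W j y)"

definition laplacian :: "(real^'n \<Rightarrow> real^'m) \<Rightarrow> real^'n \<Rightarrow> real^'m" where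
  "laplacian u x = (\<Sum>i\<in>UNIV. pderiv_dir (pderiv_dir u i) i x)"

definition smooth_bounded_domain :: "(real^'n) set \<Rightarrow> bool" where
  "smooth_bounded_domain \<Omega> \<longleftrightarrow> open \<Omega> \<and> connected \<Omega> \<and> bounded \<Omega> \<and> \<Omega> \<noteq> {} \<and>
     (\<forall>p\<in>frontier \<Omega>. \<exists>U (\<psi>::real^'n \<Rightarrow> real). open U \<and> p \<in> U \<and> smooth_on U \<psi> \<and>
        (\<forall>x\<in>U. \<exists>i. pderiv_dir \<psi> i x \<noteq> 0) \<and>
        \<Omega> \<inter> U = {x\<in>U. \<psi> x < 0})"

definition test_fun :: "(real^'n) set \<Rightarrow> (real^'n \<Rightarrow> real^'m) \<Rightarrow> bool" where
  "test_fun \<Omega> \<psi> \<longleftrightarrow> smooth_on UNIV \<psi> \<and> compact (closure {x. \<psi> x \<noteq> 0}) \<and>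
     closure {x. \<psi> x \<noteq> 0} \<subseteq> \<Omega>"

text \<open>phi \<in> W^{1,2}_0(Omega;R^m) with weak partial derivatives g i: phi and g are the
  L^2(Omega) limits of a sequence of test functions and of their partial derivatives.\<close>
definition W120 :: "(real^'n) set \<Rightarrow> (real^'n \<Rightarrow> real^'m) \<Rightarrow> ('n \<Rightarrow> real^'n \<Rightarrow> real^'m) \<Rightarrow> bool" where
  "W120 \<Omega> \<phi> g \<longleftrightarrow> \<phi> \<in> borel_measurable lborel \<and> (\<forall>i. g i \<in> borel_measurable lborel) \<and>
     (\<exists>\<psi>. (\<forall>k. test_fun \<Omega> (\<psi> k)) \<and>
        ((\<lambda>k. \<integral>\<^sup>+x\<in>\<Omega>. ennreal ((norm (\<psi> k x - \<phi> x))\<^sup>2) \<partial>lborel) \<longlongrightarrow> 0) sequentially \<and>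
        (\<forall>i. ((\<lambda>k. \<integral>\<^sup>+x\<in>\<Omega>. ennreal ((norm (pderiv_dir (\<psi> k) i x - g i x))\<^sup>2) \<partial>lborel) \<longlongrightarrow> 0) sequentially))"

definition Linf_on :: "(real^'n) set \<Rightarrow> (real^'n \<Rightarrow> real^'m) \<Rightarrow> bool" where
  "Linf_on \<Omega> \<phi> \<longleftrightarrow> (\<exists>C. AE x in lborel. x \<in> \<Omega> \<longrightarrow> norm (\<phi> x) \<le> C)"

text \<open>Energy of v on Omega, where Dv i is the (weak) partial derivative of v in direction i.\<close>
definition energy :: "(real^'m \<Rightarrow> real) \<Rightarrow> (real^'n \<Rightarrow> real^'m) \<Rightarrow> ('n \<Rightarrow> real^'n \<Rightarrow> real^'m)
    \<Rightarrow> (real^'n) set \<Rightarrow> ennreal" where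
  "energy W v Dv \<Omega> = (\<integral>\<^sup>+x\<in>\<Omega>. ennreal ((1/2) * (\<Sum>i\<in>UNIV. (norm (Dv i x))\<^sup>2) + W (v x)) \<partial>lborel)"

definition globally_minimizing :: "(real^'m \<Rightarrow> real) \<Rightarrow> (real^'n \<Rightarrow> real^'m) \<Rightarrow> bool" where
  "globally_minimizing W u \<longleftrightarrow>
     (\<forall>\<Omega> \<phi> g. smooth_bounded_domain \<Omega> \<and> W120 \<Omega> \<phi> g \<and> Linf_on \<Omega> \<phi> \<longrightarrow>
        energy W u (pderiv_dir u) \<Omega> \<le>
        energy W (\<lambda>x. u x + \<phi> x) (\<lambda>i x. pderiv_dir u i x + g i x) \<Omega>)"

end

theory Submission
  imports Defs "HOL-Computational_Algebra.Polynomial"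
begin

text \<open>
  Only minimality is used, not the equation. Compare \<open>u\<close> on \<open>B\<^sub>R\<close> with the competitor
  \<open>v = u + \<zeta> (a - u)\<close>, where the cutoff \<open>\<zeta>\<close> equals \<open>1\<close> on \<open>B\<^bsub>R-1\<^esub>\<close>, so that \<open>v\<close> has energy only in the
  shell \<open>A\<^sub>R\<close> between the two balls. Since \<open>|\<nabla>\<zeta>|\<^sup>2 \<le> C \<zeta>\<close>, the energy density of \<open>v\<close> there is at most
  \<open>e(u) + C\<close>, which gives \<open>E(B\<^bsub>R-1\<^esub>) \<le> C |A\<^sub>R| = O(R\<^bsup>n-1\<^esup>)\<close>. As \<open>W\<close> vanishes only at \<open>a\<close>, it is also at
  most \<open>\<epsilon> + K e(u)\<close> for every \<open>\<epsilon> > 0\<close>, which gives the hole-filling inequality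
  \<open>E(B\<^sub>R) \<le> \<epsilon> |A\<^sub>R| + K (E(B\<^sub>R) - E(B\<^bsub>R-1\<^esub>))\<close>. Summing it over the radii \<open>R+1, \<dots>, R+k\<close> the differences
  telescope, whence \<open>E(B\<^sub>R) \<le> (C \<epsilon> + C K / k) R\<^bsup>n-1\<^esup>\<close>. That \<open>v - u\<close>, which is only \<open>C\<^sup>1\<close>, belongs to
  \<open>W\<^sub>0\<^bsup>1,2\<^esup>\<close> is shown by mollification.
\<close>

subsection \<open>Mollification\<close>

lemma pderiv_dir_eq:
  "(f has_derivative f') (at x) \<Longrightarrow> pderiv_dir f i x = f' (axis i 1)"
  unfolding pderiv_dir_def by (metis frechet_derivative_at)

text \<open>Smoothness by coinduction: \<open>f\<close> lies in a class of differentiable functions closed under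
  partial derivatives.\<close>

lemma smooth_on_class:
  assumes "f \<in> S"
    and diff: "\<And>f x. f \<in> S \<Longrightarrow> f differentiable (at x)"
    and closed: "\<And>f i. f \<in> S \<Longrightarrow> pderiv_dir f i \<in> S"
  shows "smooth_on U f"
proof -
  have "iter_pderiv f is \<in> S" for "is"
    by (induction "is") (use assms(1) closed in auto)
  then show ?thesis unfolding smooth_on_def
    by (meson continuous_at_imp_continuous_on diff differentiable_imp_continuous_within)
qed

text \<open>Differentiation under the integral sign. The product is an arbitrary bounded bilinear
  map so that the derivative may fall on either factor: on the mollifier for smoothness, on the
  approximated function for the error estimate.\<close>

lemma convolution_has_derivative:
  fixes f :: "real^'n \<Rightarrow> 'b::banach" and g :: "real^'n \<Rightarrow> 'c::real_normed_vector"
    and prd :: "'b \<Rightarrow> 'c \<Rightarrow> 'd::banach"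
  assumes bb: "bounded_bilinear prd"
    and f: "\<And>x. (f has_derivative (\<lambda>h. \<Sum>i\<in>UNIV. h$i *\<^sub>R f' i x)) (at x)"
    and f': "\<And>i. continuous_on UNIV (f' i)"
    and g: "continuous_on (cbox a b) g"
  shows "((\<lambda>x. integral (cbox a b) (\<lambda>t. prd (f (x - t)) (g t))) has_derivative
          (\<lambda>h. \<Sum>i\<in>UNIV. h$i *\<^sub>R integral (cbox a b) (\<lambda>t. prd (f' i (x - t)) (g t)))) (at x)"
proof -
  interpret bounded_bilinear prd by fact
  \<comment> \<open>\<open>leibniz_rule\<close> asks for a jointly continuous integrand whose values
    are bounded linear maps, so the derivative is assembled from coordinate projections.\<close>
  define F where "F x t = (\<Sum>i\<in>UNIV. blinfun_scaleR_left (prd (f' i (x - t)) (g t))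
      o\<^sub>L blinfun_inner_right (axis i 1 :: real^'n))" for x t
  have F: "blinfun_apply (F x t) h = (\<Sum>i\<in>UNIV. h$i *\<^sub>R prd (f' i (x - t)) (g t))" for x t h
    by (simp add: F_def blinfun.sum_left inner_axis' )
  have contf: "continuous_on UNIV f"
    using f by (meson continuous_at_imp_continuous_on has_derivative_continuous)
  have c1: "continuous_on (cbox a b) (\<lambda>t. prd (f (x - t)) (g t))" for x
    by (intro continuous_on g continuous_on_compose2[OF contf] continuous_intros) auto
  have c2: "continuous_on (cbox a b) (\<lambda>t. prd (f' i (x - t)) (g t))" for x i
    by (intro continuous_on g continuous_on_compose2[OF f'] continuous_intros) auto
  have c3: "continuous_on (UNIV \<times> cbox a b) (\<lambda>(x, t). F x t)"
    unfolding F_def split_beta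
    by (intro continuous_intros continuous_on continuous_on_compose2[OF f']
        continuous_on_compose2[OF g] bounded_linear.continuous_on[OF bounded_linear_blinfun_scaleR_left]) auto
  have F_cont: "continuous_on (cbox a b) (F x)" for x
    unfolding F_def 
    by (intro continuous_intros continuous_on continuous_on_compose2[OF f'] g
        bounded_linear.continuous_on[OF bounded_linear_blinfun_scaleR_left]) auto
  have d: "((\<lambda>x. integral (cbox a b) (\<lambda>t. prd (f (x - t)) (g t))) has_derivative
      blinfun_apply (integral (cbox a b) (F x))) (at x within UNIV)"
  proof (rule leibniz_rule[OF _ _ c3])
    fix x t
    have "((\<lambda>x. f (x - t)) has_derivative (\<lambda>h. \<Sum>i\<in>UNIV. h$i *\<^sub>R f' i (x - t))) (at x)"
      by (rule has_derivative_compose[OF _ f, where f="\<lambda>x. x - t" and f'="\<lambda>h. h"])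
        (auto intro!: derivative_eq_intros)
    then have "((\<lambda>x. prd (f (x - t)) (g t)) has_derivative
        (\<lambda>h. prd (\<Sum>i\<in>UNIV. h$i *\<^sub>R f' i (x - t)) (g t))) (at x)"
      by (rule bounded_linear.has_derivative[OF bounded_linear_left])
    moreover have "blinfun_apply (F x t) = (\<lambda>h. prd (\<Sum>i\<in>UNIV. h$i *\<^sub>R f' i (x - t)) (g t))"
      by (rule ext) (simp add: F sum_left scaleR_left)
    ultimately show "((\<lambda>x. prd (f (x - t)) (g t)) has_derivative blinfun_apply (F x t)) (at x within UNIV)"
      by simp
  qed (auto intro: integrable_continuous c1)
  have "blinfun_apply (integral (cbox a b) (F x)) =
     (\<lambda>h. \<Sum>i\<in>UNIV. h$i *\<^sub>R integral (cbox a b) (\<lambda>t. prd (f' i (x - t)) (g t)))"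
  proof
    fix h
    have "blinfun_apply (integral (cbox a b) (F x)) h
      = integral (cbox a b) (\<lambda>t. \<Sum>i\<in>UNIV. h$i *\<^sub>R prd (f' i (x - t)) (g t))"
      by (simp add: blinfun_apply_integral[OF integrable_continuous[OF F_cont]] F)
    also have "\<dots> = (\<Sum>i\<in>UNIV. h$i *\<^sub>R integral (cbox a b) (\<lambda>t. prd (f' i (x - t)) (g t)))"
      by (subst integral_sum) (auto intro: integrable_cmul[OF integrable_continuous[OF c2]])
    finally show "blinfun_apply (integral (cbox a b) (F x)) h = \<dots>" .
  qed
  with d show ?thesis by simp
qed

text \<open>The polynomial \<open>p\<close> and the exponent \<open>k\<close> make the class of bump functions closed under
  differentiation.\<close>

definition bump :: "real \<Rightarrow> real poly \<Rightarrow> nat \<Rightarrow> real \<Rightarrow> real" where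
  "bump d p k t = (if \<bar>t\<bar> < d then poly p t / (d\<^sup>2 - t\<^sup>2) ^ k * exp (- 1 / (d\<^sup>2 - t\<^sup>2)) else 0)"

text \<open>With \<open>q = d^2 - t^2\<close>, so that q' = -2t, this is the numerator left when the
  derivative of \<open>p / q^k * exp (-1/q)\<close> is put over \<open>q^(k+2)\<close>.\<close>

definition bump_step :: "real \<Rightarrow> real poly \<Rightarrow> nat \<Rightarrow> real poly" where
  "bump_step d p k = (let q = [:d\<^sup>2, 0, -1:] in
     pderiv p * q ^ 2 + smult (2 * real k) ([:0, 1:] * p * q) - smult 2 ([:0, 1:] * p))"

lemma power2_less_of_abs: "\<bar>t\<bar> < d \<Longrightarrow> t\<^sup>2 < d\<^sup>2" for t d :: real
  using power_strict_mono[of "\<bar>t\<bar>" d 2] by simp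

text \<open>One term of the exponential series; the other terms and the Lagrange remainder are
  nonnegative.\<close>

lemma power_fact_le_exp:
  fixes x :: real
  assumes "0 \<le> x"
  shows "x ^ n / fact n \<le> exp x"
proof -
  obtain t where t: "exp x = (\<Sum>m<Suc n. x ^ m / fact m) + exp t / fact (Suc n) * x ^ Suc n"
    using Maclaurin_exp_le by blast
  have "x ^ n / fact n \<le> (\<Sum>m<Suc n. x ^ m / fact m)"
    using assms by (intro member_le_sum) auto
  also have "\<dots> \<le> exp x"
    unfolding t using assms by (simp del: fact_Suc)
  finally show ?thesis .
qed

text \<open>For q = d^2 - t^2 > 0 the previous bound at 1/q gives exp(-1/q) \<le> (k+2)! q^(k+2), so
  two powers of q survive the division by q^k. This quadratic vanishing at |t| = d yields the
  derivative 0 there.\<close>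

lemma bump_bound:
  assumes "0 < d"
  shows "\<bar>bump d p k t\<bar> \<le> \<bar>poly p t\<bar> * fact (k + 2) * (d\<^sup>2 - t\<^sup>2)\<^sup>2"
proof (cases "\<bar>t\<bar> < d")
  case True
  define q where "q = d\<^sup>2 - t\<^sup>2"
  have q: "q > 0" using True assms by (simp add: q_def power2_less_of_abs)
  have "(1 / q) ^ (k + 2) / fact (k + 2) \<le> exp (1 / q)"
    by (rule power_fact_le_exp) (use q in simp)
  then have "exp (- 1 / q) * (1 / q) ^ (k + 2) \<le> fact (k + 2)"
    using q by (simp add: exp_minus field_simps del: fact_Suc)
  then have E: "exp (- 1 / q) / q ^ k \<le> fact (k + 2) * q\<^sup>2"
    using q by (simp add: field_simps power_add power2_eq_square del: fact_Suc)
  have "\<bar>bump d p k t\<bar> = \<bar>poly p t\<bar> * (exp (- 1 / q) / q ^ k)"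
    using True q by (simp add: bump_def q_def[symmetric] abs_mult)
  also have "\<dots> \<le> \<bar>poly p t\<bar> * (fact (k + 2) * q\<^sup>2)"
    by (rule mult_left_mono[OF E]) simp
  finally show ?thesis by (simp add: q_def mult.assoc)
qed (auto simp: bump_def)

lemma bump_has_derivative:
  assumes "0 < d"
  shows "(bump d p k has_real_derivative bump d (bump_step d p k) (k + 2) t) (at t)"
proof -
  consider "\<bar>t\<bar> < d" | "\<bar>t\<bar> > d" | "\<bar>t\<bar> = d" by linarith
  then show ?thesis
  proof cases
    case 1
    define q where "q = d\<^sup>2 - t\<^sup>2"
    have q: "q > 0" using 1 assms by (simp add: q_def power2_less_of_abs)
    have E: "((\<lambda>t. exp (- 1 / (d\<^sup>2 - t\<^sup>2))) has_real_derivative - exp (- 1 / q) * (2 * t) / q\<^sup>2) (at t)"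
      using q unfolding q_def by (auto intro!: derivative_eq_intros simp: power2_eq_square)
    have P: "((\<lambda>t. poly p t / (d\<^sup>2 - t\<^sup>2) ^ k) has_real_derivative
        (poly (pderiv p) t * q + 2 * real k * t * poly p t) / q ^ (k + 1)) (at t)"
    \<comment> \<open>The derivative of q^k involves the exponent k - 1, hence the case
      split.\<close>
    proof (cases k)
      case 0
      then show ?thesis using q by (auto intro!: derivative_eq_intros poly_DERIV)
    next
      case (Suc j)
      have "((\<lambda>t. (d\<^sup>2 - t\<^sup>2) ^ Suc j) has_real_derivative real (Suc j) * q ^ j * (- 2 * t)) (at t)"
        unfolding q_def by (rule derivative_eq_intros refl | simp)+
      from DERIV_divide[OF poly_DERIV[of p t] this] q show ?thesis
        unfolding Suc q_def[symmetric] by (rule_tac DERIV_cong) (auto simp: field_simps)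
    qed
    have "((\<lambda>t. poly p t / (d\<^sup>2 - t\<^sup>2) ^ k * exp (- 1 / (d\<^sup>2 - t\<^sup>2))) has_real_derivative
       bump d (bump_step d p k) (k + 2) t) (at t)"
    proof (rule DERIV_cong[OF DERIV_mult[OF P E]])
      have s: "poly (bump_step d p k) t = poly (pderiv p) t * q\<^sup>2 + 2 * real k * t * poly p t * q - 2 * t * poly p t"
        by (simp add: bump_step_def Let_def q_def power2_eq_square algebra_simps)
      show "(poly (pderiv p) t * q + 2 * real k * t * poly p t) / q ^ (k + 1) * exp (- 1 / (d\<^sup>2 - t\<^sup>2)) +
          - exp (- 1 / q) * (2 * t) / q\<^sup>2 * (poly p t / (d\<^sup>2 - t\<^sup>2) ^ k) =
          bump d (bump_step d p k) (k + 2) t"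
        unfolding bump_def q_def[symmetric] s using 1 q
        by (simp add: field_simps power2_eq_square)
    qed
    moreover have "open {t. \<bar>t\<bar> < d}" by (intro open_Collect_less continuous_intros)
    ultimately show ?thesis
      by (rule has_field_derivative_transform_within_open[where S="{t. \<bar>t\<bar> < d}"]) (use 1 in \<open>auto simp: bump_def\<close>)
  next
    case 2
    have "((\<lambda>t. 0) has_real_derivative bump d (bump_step d p k) (k + 2) t) (at t)"
      using 2 by (simp add: bump_def)
    moreover have "open {t. \<bar>t\<bar> > d}" by (intro open_Collect_less continuous_intros)
    ultimately show ?thesis
      by (rule has_field_derivative_transform_within_open[where S="{t. \<bar>t\<bar> > d}"]) (use 2 in \<open>auto simp: bump_def\<close>)
  next
    case 3
    obtain M where M: "\<And>s. s \<in> cball t 1 \<Longrightarrow> \<bar>poly p s\<bar> \<le> M"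
      using compact_imp_bounded[OF compact_continuous_image[of "cball t 1" "poly p"]]
      by (fastforce simp: bounded_iff intro: continuous_intros)
    \<comment> \<open>As |t| = d, d^2 - s^2 = (t - s)(t + s), and |t + s| \<le> 2|t| + 1 for |s - t|
      < 1. So \<open>bump_bound\<close> is quadratic in s - t, and the difference quotient is at
      most C |s - t|.\<close>
    define C where "C = M * fact (k + 2) * (2 * \<bar>t\<bar> + 1)\<^sup>2"
    have bd: "\<bar>bump d p k s\<bar> \<le> C * (s - t)\<^sup>2" if "\<bar>s - t\<bar> < 1" for s
    proof -
      have "d\<^sup>2 - s\<^sup>2 = (t - s) * (t + s)" using 3 by (auto simp: power2_eq_square algebra_simps abs_if split: if_splits)
      then have "(d\<^sup>2 - s\<^sup>2)\<^sup>2 = (s - t)\<^sup>2 * (t + s)\<^sup>2"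
        by (simp add: power_mult_distrib power2_commute)
      also have "\<dots> \<le> (s - t)\<^sup>2 * (2 * \<bar>t\<bar> + 1)\<^sup>2"
        using that by (intro mult_left_mono abs_le_square_iff[THEN iffD1]) auto
      finally have *: "(d\<^sup>2 - s\<^sup>2)\<^sup>2 \<le> (s - t)\<^sup>2 * (2 * \<bar>t\<bar> + 1)\<^sup>2" .
      have "\<bar>poly p s\<bar> \<le> M" using that by (intro M) (auto simp: dist_real_def)
      have "\<bar>bump d p k s\<bar> \<le> \<bar>poly p s\<bar> * fact (k + 2) * (d\<^sup>2 - s\<^sup>2)\<^sup>2" by (rule bump_bound[OF assms])
      also have "\<dots> \<le> M * fact (k + 2) * ((s - t)\<^sup>2 * (2 * \<bar>t\<bar> + 1)\<^sup>2)"
        using \<open>\<bar>poly p s\<bar> \<le> M\<close> by (intro mult_mono * mult_right_mono) auto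
      finally show ?thesis by (simp add: C_def mult_ac del: fact_Suc)
    qed
    have z: "bump d p k t = 0" and z': "bump d (bump_step d p k) (k + 2) t = 0" using 3 by (simp_all add: bump_def)
    have "((\<lambda>s. (bump d p k s - bump d p k t) / (s - t)) \<longlongrightarrow> 0) (at t)"
    proof (rule Lim_null_comparison)
      show "\<forall>\<^sub>F s in at t. norm ((bump d p k s - bump d p k t) / (s - t)) \<le> C * \<bar>s - t\<bar>"
        unfolding eventually_at
      proof (intro exI[of _ 1] conjI ballI impI)
        fix s assume s: "s \<noteq> t \<and> dist s t < 1"
        then have "\<bar>bump d p k s\<bar> \<le> C * \<bar>s - t\<bar> * \<bar>s - t\<bar>"
          using bd[of s] by (simp add: dist_real_def power2_eq_square mult.assoc abs_mult_self_eq)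
        then show "norm ((bump d p k s - bump d p k t) / (s - t)) \<le> C * \<bar>s - t\<bar>"
          using s by (simp add: z abs_divide pos_divide_le_eq)
      qed simp
      show "((\<lambda>s. C * \<bar>s - t\<bar>) \<longlongrightarrow> 0) (at t)"
        by (auto intro!: tendsto_eq_intros)
    qed
    then show ?thesis unfolding z' by (simp add: has_field_derivative_iff)
  qed
qed


section \<open>Product mollifiers supported in cubes\<close>

definition mollifier :: "real \<Rightarrow> real \<Rightarrow> ('n \<Rightarrow> real poly) \<Rightarrow> ('n \<Rightarrow> nat) \<Rightarrow> real^'n \<Rightarrow> real" where
  "mollifier d c p k x = c * (\<Prod>i\<in>UNIV. bump d (p i) (k i) (x$i))"

text \<open>By the product rule, differentiation in direction i changes the polynomial and the
  exponent of the i-th factor only, so the family is closed under partial derivatives with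
  \<open>d\<close> and \<open>c\<close> fixed.\<close>

lemma mollifier_has_derivative:
  fixes x :: "real^'n"
  assumes "0 < d"
  shows "(mollifier d c p k has_derivative (\<lambda>h. \<Sum>i\<in>UNIV. h$i *\<^sub>R
     mollifier d c (p(i := bump_step d (p i) (k i))) (k(i := k i + 2)) x)) (at x)"
proof -
  have b: "((\<lambda>x. bump d (p i) (k i) (x$i)) has_derivative
      (\<lambda>h. h$i * bump d (bump_step d (p i) (k i)) (k i + 2) (x$i))) (at x)" for i
    by (rule DERIV_compose_FDERIV[OF bump_has_derivative[OF assms]]) (rule bounded_linear_imp_has_derivative[OF bounded_linear_vec_nth])
  have "(mollifier d c p k has_derivative (\<lambda>h. c * (\<Sum>i\<in>UNIV.
      (h$i * bump d (bump_step d (p i) (k i)) (k i + 2) (x$i)) *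
      (\<Prod>j\<in>UNIV - {i}. bump d (p j) (k j) (x$j))))) (at x)"
    unfolding mollifier_def[abs_def] by (intro derivative_intros b)
  moreover have "mollifier d c (p(i := bump_step d (p i) (k i))) (k(i := k i + 2)) x =
      c * (bump d (bump_step d (p i) (k i)) (k i + 2) (x$i) * (\<Prod>j\<in>UNIV - {i}. bump d (p j) (k j) (x$j)))" for i
    unfolding mollifier_def by (subst prod.remove[of _ i]) (auto intro!: prod.cong)
  ultimately show ?thesis by (simp add: sum_distrib_left mult_ac)
qed

lemma continuous_on_mollifier: "0 < d \<Longrightarrow> continuous_on A (mollifier d c p k)"
  by (meson continuous_at_imp_continuous_on mollifier_has_derivative has_derivative_continuous)

lemma mem_cube_iff: "x \<in> cbox (- (\<chi> i. d)) (\<chi> i. d) \<longleftrightarrow> (\<forall>i. \<bar>x$i\<bar> \<le> d)" for x :: "real^'n"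
  by (auto simp: mem_box_cart abs_le_iff minus_le_iff)

lemma norm_le_of_mem_cube:
  fixes x :: "real^'n" and d :: real
  assumes "x \<in> cbox (- (\<chi> i. d)) (\<chi> i. d)"
  shows "norm x \<le> CARD('n) * d"
proof -
  have "norm x \<le> (\<Sum>i\<in>UNIV. \<bar>x$i\<bar>)" by (rule norm_le_l1_cart)
  also have "\<dots> \<le> (\<Sum>i\<in>(UNIV::'n set). d)"
    using assms unfolding mem_cube_iff by (intro sum_mono) auto
  finally show ?thesis by simp
qed

lemma mollifier_eq_0:
  assumes "x \<notin> cbox (- (\<chi> i. d)) (\<chi> i. d)"
  shows "mollifier d c p k x = 0"
proof -
  obtain i where "\<not> \<bar>x$i\<bar> < d"
    using assms unfolding mem_cube_iff by (meson less_imp_le)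
  then have "bump d (p i) (k i) (x$i) = 0" by (simp add: bump_def)
  then show ?thesis unfolding mollifier_def by auto
qed

text \<open>The kernel with c = 1 is continuous, nonnegative and positive at the origin, so its
  integral over the cube is positive, and \<open>c\<close> is the reciprocal.\<close>

lemma exists_unit_mollifier:
  assumes "0 < d"
  obtains c where "\<And>x::real^'n. 0 \<le> mollifier d c (\<lambda>_. 1) (\<lambda>_. 0) x"
    and "(mollifier d c (\<lambda>_. 1) (\<lambda>_. 0) has_integral 1) (cbox (- (\<chi> i. d)) (\<chi> i. d :: real^'n))"
proof -
  define m where "m = (mollifier d 1 (\<lambda>_. 1) (\<lambda>_. 0) :: real^'n \<Rightarrow> real)"
  let ?B = "cbox (- (\<chi> i. d)) (\<chi> i. d :: real^'n)"
  have pos: "0 \<le> m x" for x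
    unfolding m_def mollifier_def by (auto intro!: prod_nonneg simp: bump_def)
  have cont: "continuous_on ?B m" unfolding m_def by (rule continuous_on_mollifier[OF assms])
  have hi: "(m has_integral integral ?B m) ?B"
    using integrable_continuous[OF cont] by (simp add: integrable_integral)
  have "integral ?B m \<noteq> 0"
  proof
    assume "integral ?B m = 0"
    with hi have h0: "(m has_integral 0) ?B" by simp
    \<comment> \<open>A point of the open box shows that the cube has nonempty interior, without
      which a vanishing integral would not force the kernel to vanish.\<close>
    have "0 \<in> box (- (\<chi> i. d)) (\<chi> i. d :: real^'n)" using assms by (simp add: mem_box_cart)
    moreover from this have "0 \<in> ?B" using box_subset_cbox by blast
    ultimately have "m 0 = 0"
      using has_integral_0_cbox_imp_0[OF cont _ h0] pos by blast
    then show False using assms by (simp add: m_def mollifier_def bump_def)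
  qed
  moreover have "0 \<le> integral ?B m"
    using pos hi has_integral_nonneg by blast
  ultimately have I: "0 < integral ?B m" by simp
  have eq: "mollifier d (1 / integral ?B m) (\<lambda>_. 1) (\<lambda>_. 0) = (\<lambda>x. 1 / integral ?B m * m x)"
    by (simp add: m_def mollifier_def fun_eq_iff)
  show thesis
  proof (rule that[of "1 / integral ?B m"])
    show "0 \<le> mollifier d (1 / integral ?B m) (\<lambda>_. 1) (\<lambda>_. 0) x" for x :: "real^'n"
      unfolding eq using pos I by simp
    show "(mollifier d (1 / integral ?B m) (\<lambda>_. 1) (\<lambda>_. 0) has_integral 1) ?B"
      unfolding eq using has_integral_mult_right[OF hi, of "1 / integral ?B m"] I by simp
  qed
qed

text \<open>All derivatives fall on the mollifier and only change \<open>p\<close> and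
  \<open>k\<close>; the mollifications of one continuous function with arbitrary \<open>p\<close>,
  \<open>k\<close> therefore form a class closed under differentiation.\<close>

lemma smooth_on_mollification:
  fixes \<phi> :: "real^'n \<Rightarrow> 'b::banach"
  assumes "0 < d" "continuous_on (cbox a b) \<phi>"
  shows "smooth_on U (\<lambda>x. integral (cbox a b) (\<lambda>t. mollifier d c p k (x - t) *\<^sub>R \<phi> t))"
proof (rule smooth_on_class)
  let ?S = "{\<lambda>x. integral (cbox a b) (\<lambda>t. mollifier d c p k (x - t) *\<^sub>R \<phi> t) |p k. True}"
  show "(\<lambda>x. integral (cbox a b) (\<lambda>t. mollifier d c p k (x - t) *\<^sub>R \<phi> t)) \<in> ?S" by blast
  have D: "((\<lambda>x. integral (cbox a b) (\<lambda>t. mollifier d c p k (x - t) *\<^sub>R \<phi> t)) has_derivative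
      (\<lambda>h. \<Sum>i\<in>UNIV. h$i *\<^sub>R integral (cbox a b)
        (\<lambda>t. mollifier d c (p(i := bump_step d (p i) (k i))) (k(i := k i + 2)) (x - t) *\<^sub>R \<phi> t))) (at x)"
    for p k x
    by (rule convolution_has_derivative[OF bounded_bilinear_scaleR mollifier_has_derivative
        continuous_on_mollifier]) fact+
  then show "f differentiable (at x)" if "f \<in> ?S" for f x
    using that unfolding differentiable_def by blast
  show "pderiv_dir f i \<in> ?S" if f: "f \<in> ?S" for f i
  proof -
    obtain p k where f: "f = (\<lambda>x. integral (cbox a b) (\<lambda>t. mollifier d c p k (x - t) *\<^sub>R \<phi> t))"
      using f by blast
    have "pderiv_dir f i = (\<lambda>x. integral (cbox a b)
        (\<lambda>t. mollifier d c (p(i := bump_step d (p i) (k i))) (k(i := k i + 2)) (x - t) *\<^sub>R \<phi> t))"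
      unfolding f
      by (rule ext, subst pderiv_dir_eq[OF D], subst sum.remove[of _ i])
        (auto simp: axis_def intro!: sum.neutral)
    then show ?thesis by blast
  qed
qed

section \<open>Convolution and approximation by test functions\<close>

lemma convolution_commute:
  fixes f :: "real^'n \<Rightarrow> real" and \<phi> :: "real^'n \<Rightarrow> 'b::banach"
  assumes f: "continuous_on UNIV f" "\<And>x. x \<notin> cbox a b \<Longrightarrow> f x = 0"
    and \<phi>: "continuous_on UNIV \<phi>" "\<And>x. x \<notin> cbox a' b' \<Longrightarrow> \<phi> x = 0"
  shows "integral (cbox a b) (\<lambda>t. f t *\<^sub>R \<phi> (x - t)) = integral (cbox a' b') (\<lambda>t. f (x - t) *\<^sub>R \<phi> t)"
proof -
  have "(\<lambda>t. f t *\<^sub>R \<phi> (x - t)) integrable_on cbox a b"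
    by (intro integrable_continuous continuous_intros continuous_on_compose2[OF \<phi>(1)]
        continuous_on_subset[OF f(1)]) auto
  \<comment> \<open>Extension by zero to the whole space makes the choice of box immaterial; the
    reflection t -> x - t then identifies the two integrals.\<close>
  then have 1: "((\<lambda>t. f t *\<^sub>R \<phi> (x - t)) has_integral integral (cbox a b) (\<lambda>t. f t *\<^sub>R \<phi> (x - t))) UNIV"
    by (intro has_integral_on_superset[OF integrable_integral]) (auto simp: f(2))
  have "(\<lambda>t. f (x - t) *\<^sub>R \<phi> t) integrable_on cbox a' b'"
    by (intro integrable_continuous continuous_intros continuous_on_compose2[OF f(1)]
        continuous_on_subset[OF \<phi>(1)]) auto
  from has_integral_affinity[OF integrable_integral[OF this], of "-1" x]
  have "((\<lambda>t. f t *\<^sub>R \<phi> (x - t)) has_integral integral (cbox a' b') (\<lambda>t. f (x - t) *\<^sub>R \<phi> t))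
      ((\<lambda>t. x - t) ` cbox a' b')"
    by simp
  then have 2: "((\<lambda>t. f t *\<^sub>R \<phi> (x - t)) has_integral integral (cbox a' b') (\<lambda>t. f (x - t) *\<^sub>R \<phi> t)) UNIV"
  proof (rule has_integral_on_superset)
    fix t assume "t \<notin> (\<lambda>t. x - t) ` cbox a' b'"
    then have "x - t \<notin> cbox a' b'" by (metis diff_diff_eq2 add_diff_cancel_left' image_eqI)
    then show "f t *\<^sub>R \<phi> (x - t) = 0" by (simp add: \<phi>(2))
  qed simp
  show ?thesis by (rule has_integral_unique[OF 1 2])
qed

text \<open>Since the kernel has mass 1, the error is the integral of m(t) (f(x - t) - f(x)), a
  weighted average of differences of norm at most e.\<close>

lemma mollification_error:
  fixes m :: "real^'n \<Rightarrow> real" and f :: "real^'n \<Rightarrow> 'b::banach"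
  assumes m: "continuous_on UNIV m" "\<And>x. 0 \<le> m x" "(m has_integral 1) (cbox a b)"
    and f: "continuous_on UNIV f" "\<And>t. t \<in> cbox a b \<Longrightarrow> norm (f (x - t) - f x) \<le> e"
  shows "norm (integral (cbox a b) (\<lambda>t. m t *\<^sub>R f (x - t)) - f x) \<le> e"
proof -
  have i: "(\<lambda>t. m t *\<^sub>R f (x - t)) integrable_on cbox a b"
    by (intro integrable_continuous continuous_intros continuous_on_compose2[OF f(1)]
        continuous_on_subset[OF m(1)]) auto
  have "((\<lambda>t. m t *\<^sub>R f x) has_integral 1 *\<^sub>R f x) (cbox a b)"
    by (rule has_integral_scaleR_left[OF m(3)])
  from has_integral_diff[OF integrable_integral[OF i] this]
  have d: "((\<lambda>t. m t *\<^sub>R (f (x - t) - f x)) has_integral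
      (integral (cbox a b) (\<lambda>t. m t *\<^sub>R f (x - t)) - f x)) (cbox a b)"
    by (simp add: scaleR_diff_right)
  have e: "((\<lambda>t. m t * e) has_integral e) (cbox a b)"
    using has_integral_mult_left[OF m(3), of e] by simp
  have "norm (integral (cbox a b) (\<lambda>t. m t *\<^sub>R (f (x - t) - f x))) \<le> integral (cbox a b) (\<lambda>t. m t * e)"
    using d e m(2) f(2) by (intro integral_norm_bound_integral) (auto intro!: mult_left_mono)
  then show ?thesis unfolding integral_unique[OF d] integral_unique[OF e] .
qed

lemma eventually_uniformly_close:
  fixes f :: "real^'n \<Rightarrow> 'b::real_normed_vector"
  assumes f: "continuous_on UNIV f" and e: "0 < e"
  shows "\<forall>\<^sub>F d in at_right 0. \<forall>x\<in>ball 0 R. \<forall>t\<in>cbox (- (\<chi> i. d)) (\<chi> i. d). norm (f (x - t) - f x) \<le> e"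
proof -
  have "uniformly_continuous_on (cball 0 (R + 1)) f"
    by (rule compact_uniformly_continuous[OF continuous_on_subset[OF f]]) auto
  then obtain \<delta> where \<delta>: "\<delta> > 0" "\<And>x y. x \<in> cball 0 (R + 1) \<Longrightarrow> y \<in> cball 0 (R + 1) \<Longrightarrow> dist y x < \<delta> \<Longrightarrow> dist (f y) (f x) < e"
    unfolding uniformly_continuous_on_def using e by metis
  \<comment> \<open>For d < b the cube has all norms below min 1 \<delta>: the 1 keeps
    \<open>x - t\<close> in the ball of radius R + 1 on which f is uniformly continuous, and
    \<delta> is the modulus of continuity for e.\<close>
  define b where "b = min 1 \<delta> / CARD('n)"
  have b: "b > 0" using \<delta>(1) by (simp add: b_def)
  show ?thesis unfolding eventually_at_right[OF b] 
  proof (intro exI[of _ b] conjI allI impI ballI b)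
    fix d x t assume d: "0 < d" "d < b" and x: "x \<in> ball (0::real^'n) R"
      and t: "t \<in> cbox (- (\<chi> i. d)) (\<chi> i. d :: real^'n)"
    have "norm t \<le> CARD('n) * d" by (rule norm_le_of_mem_cube[OF t])
    also have "\<dots> < min 1 \<delta>" using d by (simp add: b_def field_simps)
    finally have t': "norm t < min 1 \<delta>" .
    then have "norm (x - t) \<le> R + 1" using x norm_triangle_ineq4[of x t] by simp
    then show "norm (f (x - t) - f x) \<le> e"
      using \<delta>(2)[of x "x - t"] x t' by (simp add: dist_norm norm_minus_commute)
  qed
qed

lemma C1_test_fun_approx:
  fixes \<phi> :: "real^'n \<Rightarrow> real^'m"
  assumes D: "\<And>x. (\<phi> has_derivative (\<lambda>h. \<Sum>i\<in>UNIV. h$i *\<^sub>R \<phi>' i x)) (at x)"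
    and \<phi>': "\<And>i. continuous_on UNIV (\<phi>' i)"
    and supp: "\<And>x. r \<le> norm x \<Longrightarrow> \<phi> x = 0" "r < R" and e: "0 < e"
  shows "\<exists>\<psi>. test_fun (ball 0 R) \<psi> \<and> (\<forall>x\<in>ball 0 R. norm (\<psi> x - \<phi> x) \<le> e \<and>
      (\<forall>i. norm (pderiv_dir \<psi> i x - \<phi>' i x) \<le> e))"
proof -
  have \<phi>: "continuous_on UNIV \<phi>"
    using D by (meson continuous_at_imp_continuous_on has_derivative_continuous)
  \<comment> \<open>For d < s the shifts have norm at most (R - r)/2, so mollification enlarges the
    support radius from r to at most (r + R)/2 < R.\<close>
  define s where "s = (R - r) / 2 / CARD('n)"
  have s: "0 < s" using supp(2) by (simp add: s_def)
  have "\<forall>\<^sub>F d in at_right 0. 0 < d \<and> d < s"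
    by (rule eventually_at_rightI[OF _ s]) auto
  moreover note eventually_uniformly_close[OF \<phi> e, of R]
  moreover have "\<forall>\<^sub>F d in at_right 0. \<forall>i\<in>UNIV. \<forall>x\<in>ball 0 R. \<forall>t\<in>cbox (- (\<chi> i. d)) (\<chi> i. d). norm (\<phi>' i (x - t) - \<phi>' i x) \<le> e"
    by (intro eventually_ball_finite ballI eventually_uniformly_close \<phi>' e) simp
  ultimately have "\<forall>\<^sub>F d in at_right 0. (0 < d \<and> d < s) \<and>
     (\<forall>x\<in>ball 0 R. \<forall>t\<in>cbox (- (\<chi> i. d)) (\<chi> i. d). norm (\<phi> (x - t) - \<phi> x) \<le> e) \<and>
     (\<forall>i\<in>UNIV. \<forall>x\<in>ball 0 R. \<forall>t\<in>cbox (- (\<chi> i. d)) (\<chi> i. d). norm (\<phi>' i (x - t) - \<phi>' i x) \<le> e)"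
    by eventually_elim blast
  from eventually_happens'[OF trivial_limit_at_right_real this] obtain d where d: "0 < d" "d < s"
    and d\<phi>: "\<And>x t. x \<in> ball 0 R \<Longrightarrow> t \<in> cbox (- (\<chi> i. d)) (\<chi> i. d) \<Longrightarrow> norm (\<phi> (x - t) - \<phi> x) \<le> e"
    and d\<phi>': "\<And>i x t. x \<in> ball 0 R \<Longrightarrow> t \<in> cbox (- (\<chi> i. d)) (\<chi> i. d) \<Longrightarrow> norm (\<phi>' i (x - t) - \<phi>' i x) \<le> e"
    by blast
  define Q where "Q = cbox (- (\<chi> i. d)) (\<chi> i. d :: real^'n)"
  obtain c where c: "\<And>x::real^'n. 0 \<le> mollifier d c (\<lambda>_. 1) (\<lambda>_. 0) x"
    "(mollifier d c (\<lambda>_. 1) (\<lambda>_. 0) has_integral 1) Q"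
    unfolding Q_def using exists_unit_mollifier[OF d(1)] by blast
  define m where "m = (mollifier d c (\<lambda>_. 1) (\<lambda>_. 0) :: real^'n \<Rightarrow> real)"
  have m: "continuous_on UNIV m" unfolding m_def by (rule continuous_on_mollifier[OF d(1)])
  define \<psi> where "\<psi> x = integral Q (\<lambda>t. m t *\<^sub>R \<phi> (x - t))" for x
  have bnd: "norm x \<le> (r + R) / 2" if "\<psi> x \<noteq> 0" for x
  proof -
    have "\<exists>t\<in>Q. m t *\<^sub>R \<phi> (x - t) \<noteq> 0"
    proof (rule ccontr)
      assume "\<not> ?thesis"
      then have "((\<lambda>t. m t *\<^sub>R \<phi> (x - t)) has_integral 0) Q" by (intro has_integral_is_0) auto
      with that show False by (simp add: \<psi>_def integral_unique)
    qed
    then obtain t where t: "t \<in> Q" "\<phi> (x - t) \<noteq> 0" by auto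
    have "norm t \<le> CARD('n) * d" using t(1) unfolding Q_def by (rule norm_le_of_mem_cube)
    also have "\<dots> \<le> (R - r) / 2" using d by (simp add: s_def field_simps)
    finally have "norm t \<le> (R - r) / 2" .
    moreover have "norm (x - t) < r" using t(2) supp(1) not_le by blast
    ultimately show ?thesis using norm_triangle_sub[of x t] by argo
  qed
  obtain B where B: "\<And>x. x \<notin> cbox (- B) B \<Longrightarrow> \<phi> x = 0"
  proof -
    obtain B where "ball 0 r \<subseteq> cbox (- B) (B::real^'n)"
      using bounded_subset_cbox_symmetric[OF bounded_ball] by blast
    then have "x \<notin> cbox (- B) B \<Longrightarrow> \<phi> x = 0" for x by (intro supp(1)) (fastforce simp: not_less)
    then show thesis by (rule that)
  qed
  \<comment> \<open>The commuted form carries the variable in the mollifier and gives smoothness;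
    the defining form carries it in \<phi> and gives the derivatives as mollifications of
    \<phi>'.\<close>
  have "\<psi> = (\<lambda>x. integral (cbox (- B) B) (\<lambda>t. m (x - t) *\<^sub>R \<phi> t))"
    unfolding \<psi>_def Q_def
    by (intro ext convolution_commute m \<phi> B) (auto simp: m_def intro: mollifier_eq_0)
  then have smooth: "smooth_on UNIV \<psi>"
    using smooth_on_mollification[OF d(1) continuous_on_subset[OF \<phi>]] unfolding m_def by simp
  have sub: "closure {x. \<psi> x \<noteq> 0} \<subseteq> cball 0 ((r + R) / 2)"
    using bnd by (intro closure_minimal) auto
  then have "compact (closure {x. \<psi> x \<noteq> 0})"
    by (meson bounded_cball bounded_subset closed_closure compact_eq_bounded_closed)
  moreover have "closure {x. \<psi> x \<noteq> 0} \<subseteq> ball 0 R"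
    using sub supp(2) by (auto simp: subset_iff)
  ultimately have test: "test_fun (ball 0 R) \<psi>" using smooth by (simp add: test_fun_def)
  have "pderiv_dir \<psi> i x = integral Q (\<lambda>t. m t *\<^sub>R \<phi>' i (x - t))" for i x
  proof -
    have "(\<psi> has_derivative (\<lambda>h. \<Sum>i\<in>UNIV. h$i *\<^sub>R integral Q (\<lambda>t. m t *\<^sub>R \<phi>' i (x - t)))) (at x)"
      unfolding \<psi>_def[abs_def] Q_def
      by (rule convolution_has_derivative[OF bounded_bilinear.flip[OF bounded_bilinear_scaleR] D \<phi>'
            continuous_on_subset[OF m]]) auto
    then show ?thesis
      by (subst pderiv_dir_eq, assumption, subst sum.remove[of _ i])
        (auto simp: axis_def intro!: sum.neutral)
  qed
  then have "norm (\<psi> x - \<phi> x) \<le> e \<and> (\<forall>i. norm (pderiv_dir \<psi> i x - \<phi>' i x) \<le> e)" if "x \<in> ball 0 R" for x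
    using that c m d\<phi> d\<phi>' \<phi> \<phi>' unfolding \<psi>_def m_def Q_def
    by (auto intro!: mollification_error)
  with test show ?thesis by blast
qed

text \<open>Test functions with uniform error 1/(k+1) on the ball also converge in L^2, the ball
  having finite measure. One limit argument serves \<phi> and every partial derivative.\<close>

lemma W120_ball_of_C1:
  fixes \<phi> :: "real^'n \<Rightarrow> real^'m"
  assumes D: "\<And>x. (\<phi> has_derivative (\<lambda>h. \<Sum>i\<in>UNIV. h$i *\<^sub>R \<phi>' i x)) (at x)"
    and \<phi>': "\<And>i. continuous_on UNIV (\<phi>' i)"
    and supp: "\<And>x. r \<le> norm x \<Longrightarrow> \<phi> x = 0" "r < R"
  shows "W120 (ball 0 R) \<phi> \<phi>'"
proof -
  have \<phi>: "continuous_on UNIV \<phi>"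
    using D by (meson continuous_at_imp_continuous_on has_derivative_continuous)
  have "\<forall>k. \<exists>\<psi>. test_fun (ball 0 R) \<psi> \<and> (\<forall>x\<in>ball 0 R. norm (\<psi> x - \<phi> x) \<le> 1 / real (Suc k) \<and>
      (\<forall>i. norm (pderiv_dir \<psi> i x - \<phi>' i x) \<le> 1 / real (Suc k)))"
    by (intro allI C1_test_fun_approx[OF D \<phi>' supp]) auto
  then obtain \<psi> where \<psi>: "\<And>k. test_fun (ball 0 R) (\<psi> k)"
    "\<And>k x. x \<in> ball 0 R \<Longrightarrow> norm (\<psi> k x - \<phi> x) \<le> 1 / real (Suc k)"
    "\<And>k x i. x \<in> ball 0 R \<Longrightarrow> norm (pderiv_dir (\<psi> k) i x - \<phi>' i x) \<le> 1 / real (Suc k)"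
    by metis
  have lim: "((\<lambda>k. \<integral>\<^sup>+x\<in>ball 0 R. ennreal ((norm (f k x))\<^sup>2) \<partial>lborel) \<longlongrightarrow> 0) sequentially"
    if "\<And>k x. x \<in> ball 0 R \<Longrightarrow> norm (f k x) \<le> 1 / real (Suc k)"
    for f :: "nat \<Rightarrow> real^'n \<Rightarrow> real^'m"
  proof (rule tendsto_sandwich[OF _ _ tendsto_const])
    define M where "M = measure lborel (ball (0::real^'n) R)"
    have M: "emeasure lborel (ball (0::real^'n) R) = ennreal M"
      unfolding M_def by (rule emeasure_eq_ennreal_measure) (metis emeasure_lborel_ball_finite order_less_irrefl infinity_ennreal_def)
    show "\<forall>\<^sub>F k in sequentially. (\<integral>\<^sup>+x\<in>ball 0 R. ennreal ((norm (f k x))\<^sup>2) \<partial>lborel) \<le> ennreal ((1 / real (Suc k))\<^sup>2 * M)"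
    proof (intro always_eventually allI)
      fix k
      have "(\<integral>\<^sup>+x\<in>ball 0 R. ennreal ((norm (f k x))\<^sup>2) \<partial>lborel) \<le>
          (\<integral>\<^sup>+(x::real^'n). ennreal ((1 / real (Suc k))\<^sup>2) * indicator (ball 0 R) x \<partial>lborel)"
      proof (intro nn_integral_mono)
        show "ennreal ((norm (f k x))\<^sup>2) * indicator (ball 0 R) x \<le> ennreal ((1 / real (Suc k))\<^sup>2) * indicator (ball 0 R) x" for x :: "real^'n"
          using power_mono[OF that[of x k] norm_ge_zero, of 2] by (cases "x \<in> ball 0 R") (auto intro: ennreal_leI)
      qed
      also have "\<dots> = ennreal ((1 / real (Suc k))\<^sup>2 * M)"
        by (subst nn_integral_cmult_indicator) (auto simp: M ennreal_mult')
      finally show "(\<integral>\<^sup>+x\<in>ball 0 R. ennreal ((norm (f k x))\<^sup>2) \<partial>lborel) \<le> \<dots>" .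
    qed
    have "(\<lambda>k. (1 / real (Suc k))\<^sup>2 * M) \<longlonglongrightarrow> 0\<^sup>2 * M"
      by (intro tendsto_intros LIMSEQ_Suc[OF lim_1_over_n])
    then show "(\<lambda>k. ennreal ((1 / real (Suc k))\<^sup>2 * M)) \<longlonglongrightarrow> 0"
      by (simp add: tendsto_ennreal_iff flip: ennreal_0 del: ennreal_0)
  qed auto
  show ?thesis unfolding W120_def
    using \<phi> \<phi>' \<psi> lim[of "\<lambda>k x. \<psi> k x - \<phi> x"] lim[of "\<lambda>k x. pderiv_dir (\<psi> k) i x - \<phi>' i x" for i]
    by (auto intro!: borel_measurable_continuous_onI exI[of _ \<psi>])
qed

section \<open>Balls as smooth bounded domains\<close>

lemma smooth_on_norm_square_minus: "smooth_on U (\<lambda>x::real^'n. x \<bullet> x - c)"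
proof (rule smooth_on_class)
  \<comment> \<open>Partial derivatives of these quadratics are affine, hence again in the class
    with \<alpha> = 0.\<close>
  let ?S = "{\<lambda>x::real^'n. \<alpha> * (x \<bullet> x) + b \<bullet> x + c | \<alpha> b c. True}"
  have "(\<lambda>x. x \<bullet> x - c) = (\<lambda>x. 1 * (x \<bullet> x) + 0 \<bullet> x + (- c))" by auto
  then show "(\<lambda>x. x \<bullet> x - c) \<in> ?S" by blast
  have D: "((\<lambda>x. \<alpha> * (x \<bullet> x) + b \<bullet> x + c) has_derivative (\<lambda>h. 2 * \<alpha> * (h \<bullet> x) + b \<bullet> h)) (at x)"
    for \<alpha> c and b x :: "real^'n"
    by (auto intro!: derivative_eq_intros simp: inner_commute algebra_simps)
  then show "f differentiable (at x)" if "f \<in> ?S" for f x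
    using that unfolding differentiable_def by blast
  show "pderiv_dir f i \<in> ?S" if f: "f \<in> ?S" for f i
  proof -
    obtain \<alpha> b c where f: "f = (\<lambda>x. \<alpha> * (x \<bullet> x) + b \<bullet> x + c)" using f by blast
    have "pderiv_dir f i = (\<lambda>x. 0 * (x \<bullet> x) + (2 * \<alpha>) *\<^sub>R axis i 1 \<bullet> x + b $ i)"
      unfolding f by (rule ext, subst pderiv_dir_eq[OF D]) (simp add: inner_axis)
    then show ?thesis by blast
  qed
qed

text \<open>The defining function x . x - R^2 has gradient 2x, so the complement of the origin
  serves as neighbourhood of every boundary point.\<close>

lemma smooth_bounded_domain_ball:
  assumes "0 < R"
  shows "smooth_bounded_domain (ball (0::real^'n) R)"
  unfolding smooth_bounded_domain_def
proof (intro conjI ballI)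
  fix p :: "real^'n" assume p: "p \<in> frontier (ball 0 R)"
  define \<psi> where "\<psi> x = x \<bullet> x - R\<^sup>2" for x :: "real^'n"
  have "pderiv_dir \<psi> i x = 2 * x $ i" for i x
    by (subst pderiv_dir_eq[where f'="\<lambda>h. 2 * (h \<bullet> x)"])
      (auto simp: \<psi>_def[abs_def] inner_axis inner_axis' inner_commute intro!: derivative_eq_intros)
  then have "\<forall>x\<in>-{0}. \<exists>i. pderiv_dir \<psi> i x \<noteq> 0" by (auto simp: vec_eq_iff)
  moreover have "ball 0 R \<inter> - {0} = {x \<in> - {0}. \<psi> x < 0}"
    using assms by (auto simp: \<psi>_def power2_norm_eq_inner[symmetric] intro: power_strict_mono dest: power_less_imp_less_base)
  moreover have "smooth_on (- {0}) \<psi>" unfolding \<psi>_def[abs_def] by (rule smooth_on_norm_square_minus)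
  moreover have "p \<in> - {0}" using p assms by auto
  ultimately show "\<exists>U (\<psi>::real^'n \<Rightarrow> real). open U \<and> p \<in> U \<and> smooth_on U \<psi> \<and>
        (\<forall>x\<in>U. \<exists>i. pderiv_dir \<psi> i x \<noteq> 0) \<and> ball 0 R \<inter> U = {x\<in>U. \<psi> x < 0}"
    by (intro exI[of _ "- {0}"] exI[of _ \<psi>]) auto
qed (use assms in auto)

subsection \<open>Comparison on a shell and growth\<close>

text \<open>The telescoping sum costs O(R^N) in total however many steps are taken, so averaging
  over a large number k of steps makes its share of R^N small; k is fixed before R tends to
  infinity.\<close>

lemma growth_from_unit_shifts:
  fixes F :: "real \<Rightarrow> real"
  assumes pos: "\<And>R. 0 \<le> F R"
    and mono: "\<And>R R'. 0 \<le> R \<Longrightarrow> R \<le> R' \<Longrightarrow> F R \<le> F R'"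
    and C: "0 \<le> C" "\<And>R. 1 < R \<Longrightarrow> F (R - 1) \<le> C * R ^ N"
    and K: "\<And>\<epsilon>. 0 < \<epsilon> \<Longrightarrow> \<exists>K\<ge>0. \<forall>R>1. F R \<le> \<epsilon> * R ^ N + K * (F R - F (R - 1))"
  shows "((\<lambda>R. F R / R ^ N) \<longlongrightarrow> 0) at_top"
proof (rule tendstoI)
  fix e :: real assume e: "0 < e"
  \<comment> \<open>For R > k the radii used stay below 2R, so the \<epsilon> terms contribute
    \<epsilon> (2R)^N = (e/2) R^N.\<close>
  define \<epsilon> where "\<epsilon> = e / 2 / 2 ^ N"
  have \<epsilon>: "0 < \<epsilon>" using e by (simp add: \<epsilon>_def)
  obtain K where K0: "0 \<le> K" and K: "\<And>R. 1 < R \<Longrightarrow> F R \<le> \<epsilon> * R ^ N + K * (F R - F (R - 1))"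
    using K[OF \<epsilon>] by blast
  \<comment> \<open>The other half of e: K C 3^N / k < e/2, where 3^N comes from R + k + 1 \<le>
    3R.\<close>
  obtain k :: nat where k: "2 * K * C * 3 ^ N / e < k" using reals_Archimedean2 by blast
  have "0 \<le> 2 * K * C * 3 ^ N / e" using K0 C(1) e by simp
  with k have k0: "0 < k" by (metis le_less_trans of_nat_0_less_iff)
  have "K * C * 3 ^ N / k < e / 2" using k e k0 by (simp add: field_simps)
  then have kb: "e / 2 + K * C * 3 ^ N / k < e" by linarith
  have "dist (F R / R ^ N) 0 < e" if R: "max 1 (real k) < R" for R
  proof -
    have R': "1 < R" "real k < R" "0 < R" using R by auto
    have step: "F R \<le> \<epsilon> * (2 * R) ^ N + K * (F (R + real (Suc j)) - F (R + real j))" if "j < k" for j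
    proof -
      have "F R \<le> F (R + real (Suc j))" using R' by (intro mono) auto
      also have "\<dots> \<le> \<epsilon> * (R + real (Suc j)) ^ N + K * (F (R + real (Suc j)) - F (R + real (Suc j) - 1))"
        using R' by (intro K) auto
      also have "\<dots> \<le> \<epsilon> * (2 * R) ^ N + K * (F (R + real (Suc j)) - F (R + real j))"
      proof -
        have "real (Suc j) \<le> R" using that R'(2) by linarith
        then have "\<epsilon> * (R + real (Suc j)) ^ N \<le> \<epsilon> * (2 * R) ^ N"
          using R' \<epsilon> by (intro mult_left_mono power_mono) auto
        moreover have *: "R + real (Suc j) - 1 = R + real j" by simp
        ultimately show ?thesis unfolding * by simp
      qed
      finally show ?thesis .
    qed
    have "k * F R = (\<Sum>j<k. F R)" by simp
    also have "\<dots> \<le> (\<Sum>j<k. \<epsilon> * (2 * R) ^ N + K * (F (R + real (Suc j)) - F (R + real j)))"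
      by (intro sum_mono step) simp
    also have "\<dots> = k * (\<epsilon> * (2 * R) ^ N) + K * (F (R + k) - F R)"
      using sum_lessThan_telescope[of "\<lambda>j. F (R + real j)" k]
      by (simp add: sum.distrib sum_distrib_left[symmetric] del: of_nat_Suc)
    also have "\<dots> \<le> k * (\<epsilon> * (2 * R) ^ N) + K * (C * (3 * R) ^ N)"
    proof -
      \<comment> \<open>The growth hypothesis controls F one unit inside the given radius, hence its
        use at R + k + 1.\<close>
      have "F (R + k) \<le> C * (R + k + 1) ^ N" using C(2)[of "R + k + 1"] R' by simp
      also have "\<dots> \<le> C * (3 * R) ^ N" using R' C(1) by (intro mult_left_mono power_mono) auto
      finally show ?thesis using K0 pos[of R] by (intro add_left_mono mult_left_mono) linarith+
    qed
    also have "\<dots> = k * R ^ N * (e / 2 + K * C * 3 ^ N / k)"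
      using k0 by (simp add: \<epsilon>_def power_mult_distrib field_simps)
    also have "\<dots> < k * R ^ N * e" using k0 R' by (intro mult_strict_left_mono kb) auto
    finally have "F R / R ^ N < e" using k0 R' by (simp add: field_simps)
    then show ?thesis using pos[of R] R' by (simp add: dist_real_def)
  qed
  then show "\<forall>\<^sub>F R in at_top. dist (F R / R ^ N) 0 < e"
    by (rule eventually_mono[OF eventually_gt_at_top])
qed

text \<open>Bernoulli's inequality for (1 - 1/R)^n, multiplied by R^n. It makes the volume of a
  unit-width shell O(R^(n-1)).\<close>

lemma power_minus_shift_le:
  fixes R :: real
  assumes "1 \<le> R"
  shows "R ^ n - (R - 1) ^ n \<le> n * R ^ (n - 1)"
proof (cases n)
  case (Suc m)
  have "1 + real n * (- 1 / R) \<le> (1 + - 1 / R) ^ n"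
    using assms by (intro Bernoulli_inequality) (simp add: field_simps)
  then have "R ^ n * (1 + real n * (- 1 / R)) \<le> R ^ n * (1 + - 1 / R) ^ n"
    using assms by (intro mult_left_mono) auto
  also have "\<dots> = (R - 1) ^ n" 
    using assms by (simp add: power_mult_distrib[symmetric] algebra_simps)
  finally have "R ^ n * (1 + real n * (- 1 / R)) \<le> (R - 1) ^ n" .
  moreover have "R ^ n * (1 + real n * (- 1 / R)) = R ^ n - n * R ^ (n - 1)"
    using assms by (simp add: Suc right_diff_distrib)
  ultimately show ?thesis by simp
qed simp

section \<open>Integration over balls and shells\<close>

lemma set_integrable_continuous_bounded:
  fixes f :: "real^'n \<Rightarrow> real"
  assumes "continuous_on UNIV f" "S \<in> sets borel" "bounded S"
  shows "set_integrable lborel S f"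
proof -
  obtain r where "S \<subseteq> cball 0 r" using assms(3) unfolding bounded_iff by (auto simp: subset_iff)
  moreover have "set_integrable lborel (cball 0 r) f"
    unfolding set_integrable_def
    by (intro borel_integrable_compact continuous_on_subset[OF assms(1)]) auto
  ultimately show ?thesis using assms(2) by (auto intro: set_integrable_subset)
qed

text \<open>Passage from \<open>ennreal\<close>-valued energies to real integrals, which can be
  subtracted.\<close>

lemma nn_set_integral_continuous:
  fixes f :: "real^'n \<Rightarrow> real"
  assumes "continuous_on UNIV f" "\<And>x. 0 \<le> f x" "S \<in> sets borel" "bounded S"
  shows "(\<integral>\<^sup>+x\<in>S. ennreal (f x) \<partial>lborel) = ennreal (LINT x:S|lborel. f x)"
proof -
  have "(\<integral>\<^sup>+x\<in>S. ennreal (f x) \<partial>lborel) = (\<integral>\<^sup>+x. ennreal (indicator S x *\<^sub>R f x) \<partial>lborel)"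
    by (intro nn_integral_cong) (auto simp: indicator_def)
  also have "\<dots> = ennreal (LINT x:S|lborel. f x)"
    unfolding set_lebesgue_integral_def
    using set_integrable_continuous_bounded[OF assms(1,3,4)] assms(2)
    by (intro nn_integral_eq_integral) (auto simp: set_integrable_def)
  finally show ?thesis .
qed

text \<open>Only the shell contributes to the integral of f, and there A + K e dominates; A is
  multiplied by the shell volume. With K = 1 the integral over the large ball cancels; with A small
  and K large this is the hole-filling inequality.\<close>

lemma shell_comparison:
  fixes e f :: "real^'n \<Rightarrow> real"
  assumes e: "continuous_on UNIV e" "\<And>x. 0 \<le> e x"
    and f: "continuous_on UNIV f" "\<And>x. 0 \<le> f x"
    and min: "(\<integral>\<^sup>+x\<in>ball 0 R. ennreal (e x) \<partial>lborel) \<le> (\<integral>\<^sup>+x\<in>ball 0 R. ennreal (f x) \<partial>lborel)"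
    and inner: "\<And>x. norm x < R - 1 \<Longrightarrow> f x = 0"
    and shell: "\<And>x. norm x < R \<Longrightarrow> f x \<le> A + K * e x"
    and A: "0 \<le> A" and R: "1 < R"
  shows "(LINT x:ball 0 R|lborel. e x) \<le>
      A * (CARD('n) * measure lborel (ball (0::real^'n) 1)) * R ^ (CARD('n) - 1) +
      K * ((LINT x:ball 0 R|lborel. e x) - (LINT x:ball 0 (R - 1)|lborel. e x))"
proof -
  let ?I = "\<lambda>S g. LINT x:S|lborel. (g x :: real)"
  let ?B = "ball (0::real^'n) R" and ?B' = "ball (0::real^'n) (R - 1)"
  define v where "v = measure lborel (ball (0::real^'n) 1)"
  have si: "set_integrable lborel (ball 0 r) g" if "continuous_on UNIV g" for g :: "real^'n \<Rightarrow> real" and r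
    using that by (rule set_integrable_continuous_bounded) auto
  have cg: "continuous_on UNIV (\<lambda>x. A + K * e x)" by (intro continuous_intros e)
  have "ennreal (?I ?B e) \<le> ennreal (?I ?B f)"
    using min by (simp add: nn_set_integral_continuous e f)
  moreover have "0 \<le> ?I ?B f" unfolding set_lebesgue_integral_def
    using f(2) by (intro integral_nonneg_AE) auto
  ultimately have "?I ?B e \<le> ?I ?B f" by simp
  also have "\<dots> \<le> ?I (?B - ?B') (\<lambda>x. A + K * e x)"
    unfolding set_lebesgue_integral_def
  proof (rule integral_mono)
    show "integrable lborel (\<lambda>x. indicat_real ?B x *\<^sub>R f x)"
      using si[OF f(1)] by (simp add: set_integrable_def)
    show "integrable lborel (\<lambda>x. indicat_real (?B - ?B') x *\<^sub>R (A + K * e x))"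
      using set_integrable_continuous_bounded[OF cg, of "?B - ?B'"] bounded_subset[OF bounded_ball, of "?B - ?B'" 0 R]
      by (simp add: set_integrable_def)
    show "indicat_real ?B x *\<^sub>R f x \<le> indicat_real (?B - ?B') x *\<^sub>R (A + K * e x)" for x
      using inner[of x] shell[of x] by (auto simp: indicator_def)
  qed
  also have "\<dots> = ?I ?B (\<lambda>x. A + K * e x) - ?I ?B' (\<lambda>x. A + K * e x)"
  proof -
    have "?B' \<union> (?B - ?B') = ?B" by auto
    then show ?thesis
      using set_integral_Un[of ?B' "?B - ?B'" lborel "\<lambda>x. A + K * e x"] si[OF cg]
        set_integrable_subset[OF si[OF cg, of R], of "?B - ?B'"] by auto
  qed
  also have "\<dots> = A * (measure lborel ?B - measure lborel ?B') + K * (?I ?B e - ?I ?B' e)"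
  proof -
    have "?I (ball 0 r) (\<lambda>x. A + K * e x) = A * measure lborel (ball (0::real^'n) r) + K * ?I (ball 0 r) e" for r
    proof -
      have "?I (ball 0 r) (\<lambda>x. A + K * e x) = ?I (ball 0 r) (\<lambda>x::real^'n. A) + ?I (ball 0 r) (\<lambda>x. K * e x)"
        by (intro set_integral_add(2) si continuous_intros e)
      then show ?thesis by (simp add: set_lebesgue_integral_def)
    qed
    then show ?thesis by (simp add: algebra_simps)
  qed
  also have "measure lborel ?B - measure lborel ?B' = (R ^ CARD('n) - (R - 1) ^ CARD('n)) * v"
    using R content_ball_conv_unit_ball[of R "0::real^'n"] content_ball_conv_unit_ball[of "R - 1" "0::real^'n"]
    by (simp add: v_def algebra_simps)
  also have "A * \<dots> \<le> A * (CARD('n) * R ^ (CARD('n) - 1) * v)"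
    using R A power_minus_shift_le[of R "CARD('n)"] by (intro mult_left_mono mult_right_mono) (auto simp: v_def)
  finally show ?thesis by (simp add: v_def mult_ac)
qed

subsection \<open>The competitor\<close>

text \<open>Away from 0 the function is locally 0 or s^2; at 0 the difference quotient equals
  \<open>max 0 y\<close>, which tends to 0.\<close>

lemma pos_part_square_has_derivative:
  fixes s :: real
  shows "((\<lambda>s. (max 0 s)\<^sup>2) has_real_derivative 2 * max 0 s) (at s)"
proof -
  consider "s < 0" | "s > 0" | "s = 0" by linarith
  then show ?thesis
  proof cases
    case 1
    have "((\<lambda>s. 0) has_real_derivative 2 * max 0 s) (at s)" using 1 by simp
    then show ?thesis
      by (rule has_field_derivative_transform_within_open[where S="{..<0}"]) (use 1 in auto)
  next
    case 2
    have "((\<lambda>s. s\<^sup>2) has_real_derivative 2 * max 0 s) (at s)"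
      using 2 by (auto intro!: derivative_eq_intros)
    then show ?thesis
      by (rule has_field_derivative_transform_within_open[where S="{0<..}"]) (use 2 in auto)
  next
    case 3
    have "((\<lambda>y. max 0 y) \<longlongrightarrow> max 0 0) (at (0::real))" by (intro tendsto_intros)
    moreover have "\<forall>\<^sub>F y in at 0. max 0 y = ((max 0 y)\<^sup>2 - (max 0 0)\<^sup>2) / (y - (0::real))"
      by (auto simp: eventually_at_filter max_def power2_eq_square)
    ultimately show ?thesis
      unfolding 3 has_field_derivative_iff by (simp add: tendsto_cong)
  qed
qed

text \<open>Built from \<open>s \<mapsto> (max 0 s)\<^sup>2\<close>, which is \<open>C\<^sup>1\<close> and satisfies \<open>|h'|\<^sup>2 \<le> 4 h\<close>; using \<open>x \<bullet> x\<close> instead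
  of the norm avoids the singularity at the origin.\<close>

definition cutoff :: "real \<Rightarrow> real^'n \<Rightarrow> real" where
  "cutoff R x = (max 0 (1 - (max 0 ((x \<bullet> x - (R - 1)\<^sup>2) / R))\<^sup>2))\<^sup>2"

definition cutoff_grad :: "real \<Rightarrow> 'n \<Rightarrow> real^'n \<Rightarrow> real" where
  "cutoff_grad R i x = (let s = max 0 ((x \<bullet> x - (R - 1)\<^sup>2) / R) in
     2 * max 0 (1 - s\<^sup>2) * (- (2 * s * (2 * x$i / R))))"

lemma cutoff_has_derivative:
  fixes x :: "real^'n"
  assumes "0 < R"
  shows "(cutoff R has_derivative (\<lambda>h. \<Sum>i\<in>UNIV. h$i *\<^sub>R cutoff_grad R i x)) (at x)"
proof -
  have 1: "((\<lambda>x::real^'n. (x \<bullet> x - (R - 1)\<^sup>2) / R) has_derivative (\<lambda>h. 2 * (h \<bullet> x) / R)) (at x)"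
    using assms by (auto intro!: derivative_eq_intros simp: inner_commute field_simps)
  have 2: "((\<lambda>x::real^'n. 1 - (max 0 ((x \<bullet> x - (R - 1)\<^sup>2) / R))\<^sup>2) has_derivative
      (\<lambda>h. - (2 * (h \<bullet> x) / R * (2 * max 0 ((x \<bullet> x - (R - 1)\<^sup>2) / R))))) (at x)"
    using has_derivative_diff[OF has_derivative_const[of 1]
        DERIV_compose_FDERIV[OF pos_part_square_has_derivative 1]] by simp
  have "(cutoff R has_derivative (\<lambda>h. - (2 * (h \<bullet> x) / R * (2 * max 0 ((x \<bullet> x - (R - 1)\<^sup>2) / R))) *
      (2 * max 0 (1 - (max 0 ((x \<bullet> x - (R - 1)\<^sup>2) / R))\<^sup>2)))) (at x)"
    unfolding cutoff_def[abs_def] by (rule DERIV_compose_FDERIV[OF pos_part_square_has_derivative 2])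
  then show ?thesis
    by (rule has_derivative_eq_rhs)
      (auto simp: cutoff_grad_def Let_def inner_vec_def sum_distrib_left sum_distrib_right
        sum_divide_distrib sum_negf[symmetric] fun_eq_iff algebra_simps intro!: sum.cong)
qed

lemma cutoff_bounds: "0 \<le> cutoff R x" "cutoff R x \<le> 1"
  unfolding cutoff_def by (auto intro!: power_le_one)

lemma cutoff_inner:
  assumes "norm x \<le> R - 1"
  shows "cutoff R x = 1" "cutoff_grad R i x = 0"
proof -
  have "x \<bullet> x \<le> (R - 1)\<^sup>2"
    unfolding power2_norm_eq_inner[symmetric] using assms by (intro power_mono) auto
  moreover have "0 \<le> R" using assms norm_ge_zero[of x] by linarith
  ultimately have s: "max 0 ((x \<bullet> x - (R - 1)\<^sup>2) / R) = 0" by (intro max_absorb1 divide_nonpos_nonneg) auto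
  show "cutoff R x = 1" "cutoff_grad R i x = 0"
    unfolding cutoff_def cutoff_grad_def s by auto
qed

text \<open>The inner quotient reaches 1 where |x|^2 = (R - 1)^2 + R. For R > 1 this radius is less
  than R, which leaves room for mollification inside the ball.\<close>

lemma cutoff_outer:
  assumes "0 < R" "sqrt (R\<^sup>2 - R + 1) \<le> norm x"
  shows "cutoff R x = 0"
proof -
  have "R\<^sup>2 - R + 1 \<le> (norm x)\<^sup>2" using assms(2) by (simp add: sqrt_le_D)
  then have "1 \<le> (x \<bullet> x - (R - 1)\<^sup>2) / R"
    using assms(1) unfolding power2_norm_eq_inner by (simp add: field_simps power2_eq_square)
  then have "1 \<le> (max 0 ((x \<bullet> x - (R - 1)\<^sup>2) / R))\<^sup>2" by (intro one_le_power) auto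
  then show ?thesis unfolding cutoff_def by simp
qed

text \<open>With the cutoff written as t^2, the partial derivative is -8 t s x_i / R; here |x_i|
  \<le> R, and t vanishes once s \<ge> 1.\<close>

lemma cutoff_grad_square_le:
  assumes "0 < R" "norm x \<le> R"
  shows "(cutoff_grad R i x)\<^sup>2 \<le> 64 * cutoff R x"
proof -
  define s where "s = max 0 ((x \<bullet> x - (R - 1)\<^sup>2) / R)"
  define t where "t = max 0 (1 - s\<^sup>2)"
  have "\<bar>x$i\<bar> \<le> R" using assms(2) component_le_norm_cart[of x i] by linarith
  then have "\<bar>x$i / R\<bar> \<le> 1" using assms(1) by simp
  then have x: "(x$i / R)\<^sup>2 \<le> 1" by (simp add: abs_square_le_1)
  have ts: "t\<^sup>2 * s\<^sup>2 \<le> t\<^sup>2"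
  proof (cases "s\<^sup>2 \<le> 1")
    case True then show ?thesis using mult_left_mono[of "s\<^sup>2" 1 "t\<^sup>2"] by simp
  next
    case False then show ?thesis by (simp add: t_def)
  qed
  have "(cutoff_grad R i x)\<^sup>2 = 64 * (t\<^sup>2 * s\<^sup>2 * (x$i / R)\<^sup>2)"
    unfolding cutoff_grad_def Let_def s_def[symmetric] t_def[symmetric]
    by (simp add: power_mult_distrib power_divide)
  also have "\<dots> \<le> 64 * (t\<^sup>2 * 1)" using ts x by (intro mult_left_mono mult_mono) auto
  finally show ?thesis by (simp add: cutoff_def s_def[symmetric] t_def[symmetric])
qed

text \<open>With r = sqrt z one has |y| \<le> 8r, and completing the square leaves the nonpositive
  remainder -(1 - z)(r |p| - 8M)^2. The coefficient 1 of |p|^2 is what later lets the energy on the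
  large ball cancel.\<close>

lemma norm_square_interpolation_le:
  fixes p w :: "'a::real_normed_vector"
  assumes z: "0 \<le> z" "z \<le> 1" "y\<^sup>2 \<le> 64 * z" and w: "norm w \<le> M"
  shows "(norm ((1 - z) *\<^sub>R p + y *\<^sub>R w))\<^sup>2 \<le> (norm p)\<^sup>2 + 64 * M\<^sup>2"
proof -
  define P r where "P = norm p" and "r = sqrt z"
  have r: "r\<^sup>2 = z" "0 \<le> r" using z by (auto simp: r_def)
  have M: "0 \<le> M" using w norm_ge_zero[of w] by linarith
  have "\<bar>y\<bar> \<le> 8 * r"
    using z(3) r by (rule_tac power2_le_imp_le) (auto simp: power_mult_distrib)
  then have "\<bar>y\<bar> * norm w \<le> 8 * r * M" using w r by (intro mult_mono) auto
  then have "norm ((1 - z) *\<^sub>R p + y *\<^sub>R w) \<le> (1 - z) * P + 8 * r * M"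
    using norm_triangle_ineq[of "(1 - z) *\<^sub>R p" "y *\<^sub>R w"] z by (simp add: P_def)
  then have "(norm ((1 - z) *\<^sub>R p + y *\<^sub>R w))\<^sup>2 \<le> ((1 - z) * P + 8 * r * M)\<^sup>2"
    by (intro power_mono) auto
  also have "\<dots> = (1 - z) * P\<^sup>2 + 64 * M\<^sup>2 - (1 - z) * (r * P - 8 * M)\<^sup>2"
    unfolding r(1)[symmetric] by (simp add: power2_eq_square algebra_simps)
  also have "\<dots> \<le> P\<^sup>2 + 64 * M\<^sup>2"
  proof -
    have "0 \<le> (1 - z) * (r * P - 8 * M)\<^sup>2" "(1 - z) * P\<^sup>2 \<le> 1 * P\<^sup>2"
      using z mult_right_mono[of "1 - z" 1 "P\<^sup>2"] by auto
    then show ?thesis by linarith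
  qed
  finally show ?thesis by (simp add: P_def)
qed

text \<open>From (x + y)^2 \<le> 2x^2 + 2y^2. The error is a multiple of |w|^2 itself: for w = a - u
  it vanishes where the potential does and can be absorbed. The coefficient 2 is harmless in hole
  filling.\<close>

lemma norm_square_interpolation_le':
  fixes p w :: "'a::real_normed_vector"
  assumes z: "0 \<le> z" "z \<le> 1" "y\<^sup>2 \<le> 64 * z"
  shows "(norm ((1 - z) *\<^sub>R p + y *\<^sub>R w))\<^sup>2 \<le> 2 * (norm p)\<^sup>2 + 128 * (norm w)\<^sup>2"
proof -
  have "(norm ((1 - z) *\<^sub>R p + y *\<^sub>R w))\<^sup>2 \<le> ((1 - z) * norm p + \<bar>y\<bar> * norm w)\<^sup>2"
    using norm_triangle_ineq[of "(1 - z) *\<^sub>R p" "y *\<^sub>R w"] z by (intro power_mono) auto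
  also have "\<dots> \<le> 2 * ((1 - z) * norm p)\<^sup>2 + 2 * (\<bar>y\<bar> * norm w)\<^sup>2"
    using sum_squares_bound[of "(1 - z) * norm p" "\<bar>y\<bar> * norm w"] by (simp add: power2_sum)
  also have "\<dots> \<le> 2 * (norm p)\<^sup>2 + 2 * (64 * (norm w)\<^sup>2)"
  proof (intro add_mono mult_left_mono)
    show "((1 - z) * norm p)\<^sup>2 \<le> (norm p)\<^sup>2"
      using z by (intro power_mono mult_left_le_one_le) auto
    show "(\<bar>y\<bar> * norm w)\<^sup>2 \<le> 64 * (norm w)\<^sup>2"
      using z unfolding power_mult_distrib by (intro mult_right_mono) auto
  qed auto
  finally show ?thesis by simp
qed

text \<open>Near a both terms on the left are below \<epsilon>/2 by continuity. Elsewhere y lies in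
  a compact set on which W has a positive lower bound, and the left side is bounded. In the
  application y = u x and y' is the competitor's value.\<close>

lemma potential_absorption:
  fixes W :: "'a::euclidean_space \<Rightarrow> real"
  assumes W: "continuous_on UNIV W" "W a = 0" "\<And>y. y \<noteq> a \<Longrightarrow> 0 < W y" and \<epsilon>: "0 < \<epsilon>" and L: "0 \<le> L"
  shows "\<exists>K\<ge>0. \<forall>y y'. norm (y - a) \<le> M \<longrightarrow> norm (y' - a) \<le> norm (y - a) \<longrightarrow>
    W y' + L * (norm (y - a))\<^sup>2 \<le> \<epsilon> + K * W y"
proof -
  have W0: "0 \<le> W y" for y using W(2,3) by (cases "y = a") (auto simp: less_imp_le)
  have "isCont (\<lambda>y. W y) a" using W(1) by (simp add: continuous_on_eq_continuous_at)
  moreover have "isCont (\<lambda>y. L * (norm (y - a))\<^sup>2) a" by (intro continuous_intros)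
  ultimately have "\<forall>\<^sub>F y in at a. dist (W y) (W a) < \<epsilon> / 2 \<and> dist (L * (norm (y - a))\<^sup>2) (L * (norm (a - a))\<^sup>2) < \<epsilon> / 2"
    using \<epsilon> by (intro eventually_conj) (auto simp: isCont_def dest!: tendstoD[where e="\<epsilon> / 2"])
  then obtain \<delta> where \<delta>: "0 < \<delta>"
    and near: "\<And>y. dist y a < \<delta> \<Longrightarrow> y \<noteq> a \<Longrightarrow> W y < \<epsilon> / 2 \<and> L * (norm (y - a))\<^sup>2 < \<epsilon> / 2"
    using W0 L unfolding eventually_at by (auto simp: W(2) dist_real_def abs_mult)
  \<comment> \<open>The punctured filter leaves out y = a, where both quantities are 0.\<close>
  have near: "W y < \<epsilon> / 2 \<and> L * (norm (y - a))\<^sup>2 < \<epsilon> / 2" if "norm (y - a) < \<delta>" for y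
    using near[of y] that \<epsilon> by (cases "y = a") (auto simp: dist_norm W(2))
  obtain B where B: "\<And>y. y \<in> cball a M \<Longrightarrow> W y \<le> B"
  proof -
    have "bounded (W ` cball a M)"
      by (intro compact_imp_bounded compact_continuous_image continuous_on_subset[OF W(1)]) auto
    then obtain B where "\<forall>y\<in>W ` cball a M. \<bar>y\<bar> \<le> B" by (auto simp: bounded_iff)
    then show thesis by (intro that[of B]) (auto dest: abs_le_D1)
  qed
  define T where "T = cball a M - ball a \<delta>"
  have "\<exists>c>0. \<forall>y\<in>T. c \<le> W y"
  \<comment> \<open>T may be empty if M < \<delta>; then any positive c will do.\<close>
  proof (cases "T = {}")
    case False
    have "compact T" unfolding T_def by (intro compact_diff) auto
    then obtain y0 where "y0 \<in> T" "\<And>y. y \<in> T \<Longrightarrow> W y0 \<le> W y"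
      using continuous_attains_inf[OF _ False continuous_on_subset[OF W(1)]] by auto
    moreover from this have "0 < W y0" using \<delta> by (intro W(3)) (auto simp: T_def)
    ultimately show ?thesis by blast
  qed (auto intro: exI[of _ 1])
  then obtain c where c: "0 < c" "\<And>y. y \<in> T \<Longrightarrow> c \<le> W y" by blast
  define K where "K = (\<bar>B\<bar> + L * M\<^sup>2) / c"
  have K: "0 \<le> K" using c L by (simp add: K_def)
  have "W y' + L * (norm (y - a))\<^sup>2 \<le> \<epsilon> + K * W y"
    if y: "norm (y - a) \<le> M" and y': "norm (y' - a) \<le> norm (y - a)" for y y'
  proof (cases "norm (y - a) < \<delta>")
    case True
    then have "W y' + L * (norm (y - a))\<^sup>2 \<le> \<epsilon>" using near[of y] near[of y'] y' by linarith
    then show ?thesis using mult_nonneg_nonneg[OF K W0[of y]] by linarith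
  next
    case False
    then have "y \<in> T" using y by (simp add: T_def dist_norm norm_minus_commute)
    have "W y' \<le> \<bar>B\<bar>" using B[of y'] y y' by (simp add: dist_norm norm_minus_commute)
    moreover have "L * (norm (y - a))\<^sup>2 \<le> L * M\<^sup>2" using L y by (intro mult_left_mono power_mono) auto
    moreover have "K * c \<le> K * W y" using K c(2)[OF \<open>y \<in> T\<close>] by (intro mult_left_mono)
    ultimately show ?thesis using c \<epsilon> by (simp add: K_def)
  qed
  with K show ?thesis by blast
qed

lemma has_derivative_pderiv_dir:
  fixes f :: "real^'n \<Rightarrow> 'b::real_normed_vector"
  assumes "f differentiable (at x)"
  shows "(f has_derivative (\<lambda>h. \<Sum>i\<in>UNIV. h$i *\<^sub>R pderiv_dir f i x)) (at x)"
proof -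
  have d: "(f has_derivative frechet_derivative f (at x)) (at x)"
    using assms by (simp add: frechet_derivative_works)
  then interpret linear "frechet_derivative f (at x)" by (rule has_derivative_linear)
  have "frechet_derivative f (at x) = (\<lambda>h. \<Sum>i\<in>UNIV. h$i *\<^sub>R pderiv_dir f i x)"
  proof
    show "frechet_derivative f (at x) h = (\<Sum>i\<in>UNIV. h$i *\<^sub>R pderiv_dir f i x)" for h
      unfolding pderiv_dir_def by (subst basis_expansion[of h, symmetric]) (simp add: sum scale scalar_mult_eq_scaleR)
  qed
  with d show ?thesis by simp
qed


section \<open>Decay of the rescaled energy\<close>

theorem theorem1p1:
  fixes W :: "real^'m \<Rightarrow> real" and u :: "real^'n \<Rightarrow> real^'m"
  assumes "CARD('n) \<ge> 2"
    and "C1_fun W"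
    and "\<exists>a. W a = 0 \<and> (\<forall>y. y \<noteq> a \<longrightarrow> W y > 0)"
    and "C2_fun u"
    and "bounded (range u)"
    and "\<forall>x. laplacian u x = grad W (u x)"
    and "globally_minimizing W u"
  shows "((\<lambda>R. energy W u (pderiv_dir u) (ball 0 R) / ennreal (R ^ (CARD('n) - 1))) \<longlongrightarrow> 0) at_top"
proof -
  obtain a where a: "W a = 0" "\<And>y. y \<noteq> a \<Longrightarrow> 0 < W y" using assms(3) by blast
  have W0: "0 \<le> W y" for y using a by (cases "y = a") (auto simp: less_imp_le)
  have W: "continuous_on UNIV W"
    using assms(2) unfolding C1_fun_def
    by (meson continuous_at_imp_continuous_on differentiable_imp_continuous_within)
  have u': "(u has_derivative (\<lambda>h. \<Sum>i\<in>UNIV. h$i *\<^sub>R pderiv_dir u i x)) (at x)" for x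
    using assms(4) unfolding C2_fun_def by (intro has_derivative_pderiv_dir) blast
  have u: "continuous_on UNIV u"
    using u' by (meson continuous_at_imp_continuous_on has_derivative_continuous)
  have du: "continuous_on UNIV (pderiv_dir u i)" for i
    using assms(4) unfolding C2_fun_def
    by (meson continuous_at_imp_continuous_on differentiable_imp_continuous_within)
  have "bounded ((\<lambda>x. u x - a) ` UNIV)"
    using assms(5) by (intro bounded_minus_comp) (auto simp: image_constant_conv)
  then obtain M where M: "\<And>x. norm (u x - a) \<le> M" by (auto simp: bounded_iff)
  \<comment> \<open>B bounds W along both u and the competitor, whose values stay within distance M
    of a.\<close>
  obtain B where B: "\<And>y. y \<in> cball a M \<Longrightarrow> W y \<le> B"
  proof -
    have "bounded (W ` cball a M)"
      by (intro compact_imp_bounded compact_continuous_image continuous_on_subset[OF W]) auto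
    then obtain B where "\<forall>y\<in>W ` cball a M. \<bar>y\<bar> \<le> B" by (auto simp: bounded_iff)
    then show thesis by (intro that[of B]) (auto dest: abs_le_D1)
  qed
  define e where "e x = 1/2 * (\<Sum>i\<in>UNIV. (norm (pderiv_dir u i x))\<^sup>2) + W (u x)" for x
  \<comment> \<open>The competitor is u + \<phi> R; \<open>\<phi>' R\<close> collects the partial
    derivatives of the perturbation, and \<open>f R\<close> is the competitor's energy
    density.\<close>
  define \<phi> where "\<phi> R x = cutoff R x *\<^sub>R (a - u x)" for R x
  define \<phi>' where "\<phi>' R i x = cutoff_grad R i x *\<^sub>R (a - u x) - cutoff R x *\<^sub>R pderiv_dir u i x" for R i x
  define f where "f R x = 1/2 * (\<Sum>i\<in>UNIV. (norm (pderiv_dir u i x + \<phi>' R i x))\<^sup>2) + W (u x + \<phi> R x)" for R x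
  have e: "continuous_on UNIV e" "\<And>x. 0 \<le> e x"
    unfolding e_def[abs_def] using W0
    by (auto intro!: continuous_intros du continuous_on_compose2[OF W u] add_nonneg_nonneg sum_nonneg)
  have D\<phi>: "(\<phi> R has_derivative (\<lambda>h. \<Sum>i\<in>UNIV. h$i *\<^sub>R \<phi>' R i x)) (at x)" if "0 < R" for R x
  proof -
    have "(\<phi> R has_derivative (\<lambda>h. cutoff R x *\<^sub>R (0 - (\<Sum>i\<in>UNIV. h$i *\<^sub>R pderiv_dir u i x)) +
        (\<Sum>i\<in>UNIV. h$i *\<^sub>R cutoff_grad R i x) *\<^sub>R (a - u x))) (at x)"
      unfolding \<phi>_def[abs_def]
      by (intro has_derivative_scaleR has_derivative_diff has_derivative_const cutoff_has_derivative[OF that] u')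
    then show ?thesis
      by (rule has_derivative_eq_rhs)
        (auto simp: \<phi>'_def scaleR_right_diff_distrib sum_subtractf scaleR_sum_left scaleR_sum_right mult.commute)
  qed
  have \<phi>c: "continuous_on UNIV (\<phi> R)" if "0 < R" for R
    using D\<phi>[OF that] by (meson continuous_at_imp_continuous_on has_derivative_continuous)
  have \<phi>'c: "continuous_on UNIV (\<phi>' R i)" if "0 < R" for R i
  proof -
    have "continuous_on UNIV (cutoff R :: real^'n \<Rightarrow> real)"
      using cutoff_has_derivative[OF that] by (meson continuous_at_imp_continuous_on has_derivative_continuous)
    moreover have "continuous_on UNIV (cutoff_grad R i)"
      unfolding cutoff_grad_def[abs_def] Let_def using that by (intro continuous_intros) auto
    ultimately show ?thesis unfolding \<phi>'_def[abs_def] by (intro continuous_intros u du)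
  qed
  have f: "continuous_on UNIV (f R)" if "0 < R" for R
    unfolding f_def[abs_def]
    by (intro continuous_intros du \<phi>'c that continuous_on_compose2[OF W] u \<phi>c) auto
  have f0: "0 \<le> f R x" for R x unfolding f_def using W0 by (auto intro!: add_nonneg_nonneg sum_nonneg)
  have min: "(\<integral>\<^sup>+x\<in>ball 0 R. ennreal (e x) \<partial>lborel) \<le> (\<integral>\<^sup>+x\<in>ball 0 R. ennreal (f R x) \<partial>lborel)" if R: "1 < R" for R
  proof -
    \<comment> \<open>The support radius of the cutoff must be strictly below R, which holds exactly
      because R > 1.\<close>
    have "sqrt (R\<^sup>2 - R + 1) < sqrt (R\<^sup>2)" using R by (intro real_sqrt_less_mono) simp
    then have "sqrt (R\<^sup>2 - R + 1) < R" using R by simp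
    then have "W120 (ball 0 R) (\<phi> R) (\<phi>' R)"
      using R by (intro W120_ball_of_C1 D\<phi> \<phi>'c) (auto simp: \<phi>_def cutoff_outer)
    moreover have "norm (\<phi> R x) \<le> M" for x
      using M[of x] cutoff_bounds[of R x] mult_left_le_one_le[of "norm (a - u x)" "cutoff R x"]
      by (auto simp: \<phi>_def norm_minus_commute)
    then have "Linf_on (ball 0 R) (\<phi> R)" unfolding Linf_on_def by (intro exI[of _ M]) simp
    ultimately show ?thesis
      using assms(7) smooth_bounded_domain_ball[of R] R
      unfolding globally_minimizing_def energy_def e_def f_def by fastforce
  qed
  \<comment> \<open>The form of the interpolation estimates, with z the cutoff, y its partial
    derivative and w = a - u.\<close>
  have Dv: "pderiv_dir u i x + \<phi>' R i x = (1 - cutoff R x) *\<^sub>R pderiv_dir u i x + cutoff_grad R i x *\<^sub>R (a - u x)" for R i x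
    by (simp add: \<phi>'_def algebra_simps)
  have va: "norm (u x + \<phi> R x - a) \<le> norm (u x - a)" for R x
  proof -
    have "u x + \<phi> R x - a = (1 - cutoff R x) *\<^sub>R (u x - a)" by (simp add: \<phi>_def algebra_simps)
    then show ?thesis using cutoff_bounds[of R x] by (simp add: mult_left_le_one_le)
  qed
  have inner: "f R x = 0" if "norm x < R - 1" for R x
  proof -
    have "cutoff R x = 1" "cutoff_grad R i x = 0" for i using cutoff_inner[of x R] that by auto
    then show ?thesis unfolding f_def Dv by (simp add: \<phi>_def a(1))
  qed
  \<comment> \<open>c R^(n-1) bounds the volume of the shell.\<close>
  define c where "c = CARD('n) * measure lborel (ball (0::real^'n) 1)"
  have c: "0 < c" using content_ball_pos[of 1 "0::real^'n"] by (simp add: c_def)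
  define F where "F R = (LINT x:ball 0 R|lborel. e x)" for R
  have comparison: "F R \<le> A * c * R ^ (CARD('n) - 1) + K * (F R - F (R - 1))"
    if "1 < R" "0 \<le> A" "\<And>x. norm x < R \<Longrightarrow> f R x \<le> A + K * e x" for A K R
    unfolding F_def c_def using that by (intro shell_comparison[where f="f R"] e f f0 min inner) auto
  have F0: "0 \<le> F R" for R
    unfolding F_def set_lebesgue_integral_def using e(2) by (intro integral_nonneg_AE) auto
  have energy: "energy W u (pderiv_dir u) (ball 0 R) = ennreal (F R)" for R
    using nn_set_integral_continuous[OF e, of "ball 0 R"] by (simp add: energy_def e_def F_def)
  have Fmono: "F R \<le> F R'" if "R \<le> R'" for R R'
  proof -
    have "ennreal (F R) \<le> ennreal (F R')"
      unfolding energy[symmetric] energy_def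
      by (intro nn_integral_mono) (use that in \<open>auto simp: indicator_def\<close>)
    then show ?thesis using F0 by simp
  qed
  \<comment> \<open>The 32 M^2 is half of 64 M^2, once for each direction. The factor of
    \<open>e x\<close> is exactly 1.\<close>
  have bounded_shell: "f R x \<le> CARD('n) * (32 * M\<^sup>2) + \<bar>B\<bar> + 1 * e x" if "1 < R" "norm x < R" for R x
  proof -
    have "(\<Sum>i\<in>UNIV. (norm (pderiv_dir u i x + \<phi>' R i x))\<^sup>2) \<le>
        (\<Sum>i\<in>UNIV. (norm (pderiv_dir u i x))\<^sup>2 + 64 * M\<^sup>2)"
      unfolding Dv using M that
      by (intro sum_mono norm_square_interpolation_le cutoff_bounds cutoff_grad_square_le)
        (auto simp: norm_minus_commute)
    moreover have "W (u x + \<phi> R x) \<le> \<bar>B\<bar>"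
      using B[of "u x + \<phi> R x"] va[of x R] M[of x] by (simp add: dist_norm norm_minus_commute)
    ultimately show ?thesis using W0[of "u x"] by (simp add: f_def e_def sum.distrib)
  qed
  \<comment> \<open>K depends on \<epsilon> but not on R.\<close>
  have absorbed_shell: "\<exists>K\<ge>0. \<forall>R>1. \<forall>x. norm x < R \<longrightarrow> f R x \<le> \<epsilon> + K * e x" if \<epsilon>: "0 < \<epsilon>" for \<epsilon>
  proof -
    \<comment> \<open>The constant is half of the 128 from the interpolation estimate, summed over
      the directions.\<close>
    obtain K where K: "0 \<le> K" "\<And>y y'. norm (y - a) \<le> M \<Longrightarrow> norm (y' - a) \<le> norm (y - a) \<Longrightarrow>
        W y' + CARD('n) * 64 * (norm (y - a))\<^sup>2 \<le> \<epsilon> + K * W y"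
      using potential_absorption[OF W a \<epsilon>, of "CARD('n) * 64" M] by auto
    \<comment> \<open>The extra 2 pays for the gradient sum, which equals 2 (e x - W (u x)).\<close>
    have "f R x \<le> \<epsilon> + (K + 2) * e x" if "1 < R" "norm x < R" for R x
    proof -
      let ?S = "\<Sum>i\<in>UNIV. (norm (pderiv_dir u i x))\<^sup>2"
      have "(\<Sum>i\<in>UNIV. (norm (pderiv_dir u i x + \<phi>' R i x))\<^sup>2) \<le>
          (\<Sum>i\<in>UNIV. 2 * (norm (pderiv_dir u i x))\<^sup>2 + 128 * (norm (a - u x))\<^sup>2)"
        unfolding Dv using that
        by (intro sum_mono norm_square_interpolation_le' cutoff_bounds cutoff_grad_square_le) auto
      then have "f R x \<le> ?S + (W (u x + \<phi> R x) + CARD('n) * 64 * (norm (u x - a))\<^sup>2)"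
        by (simp add: f_def sum.distrib sum_distrib_left[symmetric] norm_minus_commute)
      also have "\<dots> \<le> ?S + (\<epsilon> + K * W (u x))" by (intro add_left_mono K(2) M va)
      also have "\<dots> \<le> \<epsilon> + (K + 2) * e x"
      proof -
        have "0 \<le> K * ?S" using K(1) by (intro mult_nonneg_nonneg sum_nonneg) auto
        then show ?thesis using W0[of "u x"] by (simp add: e_def algebra_simps add_divide_distrib)
      qed
      finally show ?thesis .
    qed
    then show ?thesis using K(1) by (intro exI[of _ "K + 2"]) auto
  qed
  have "((\<lambda>R. F R / R ^ (CARD('n) - 1)) \<longlongrightarrow> 0) at_top"
  proof (rule growth_from_unit_shifts)
    let ?A = "CARD('n) * (32 * M\<^sup>2) + \<bar>B\<bar>"
    show "0 \<le> ?A * c" using c by simp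
    show "F (R - 1) \<le> ?A * c * R ^ (CARD('n) - 1)" if "1 < R" for R
      \<comment> \<open>With K = 1 the terms F R cancel and a bound on F (R - 1) remains.\<close>
      using comparison[OF that, of ?A 1] bounded_shell[OF that] by simp
    show "\<exists>K\<ge>0. \<forall>R>1. F R \<le> \<epsilon> * R ^ (CARD('n) - 1) + K * (F R - F (R - 1))" if \<epsilon>: "0 < \<epsilon>" for \<epsilon>
    proof -
      obtain K where "0 \<le> K" "\<And>R x. 1 < R \<Longrightarrow> norm x < R \<Longrightarrow> f R x \<le> \<epsilon> / c + K * e x"
        \<comment> \<open>Division by c offsets the shell factor in
          \<open>comparison\<close>.\<close>
        using absorbed_shell[of "\<epsilon> / c"] \<epsilon> c by auto
      then show ?thesis using comparison[of _ "\<epsilon> / c" K] \<epsilon> c by (intro exI[of _ K]) auto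
    qed
  qed (use F0 Fmono in auto)
  then have "((\<lambda>R. ennreal (F R / R ^ (CARD('n) - 1))) \<longlongrightarrow> ennreal 0) at_top" by (rule tendsto_ennrealI)
  moreover have "\<forall>\<^sub>F R in at_top. ennreal (F R / R ^ (CARD('n) - 1)) =
      energy W u (pderiv_dir u) (ball 0 R) / ennreal (R ^ (CARD('n) - 1))"
    using eventually_gt_at_top[of 0] by eventually_elim (simp add: energy F0 divide_ennreal)
  ultimately show ?thesis by (simp add: tendsto_cong)
qed

end
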